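(* Let $w^1,\dots,w^d\in S_n$ with $\ell(w^1)+\cdots+\ell(w^d)=\binom n2$, and for generic complete flags $E^1_\bullet,\dots,E^d_\bullet$ in $\mathbb{C}^n$ let $X=X_{w^1}(E^1_\bullet)\cap\cdots\cap X_{w^d}(E^d_\bullet)$. Let $P\subseteq[n]^{d+1}$ be the permutation array which describes the dimensions $\dim(E^1_{x_1}\cap\cdots\cap E^d_{x_d}\cap F_{x_{d+1}})$ for any flag $F_\bullet\in X$, that is, $$\dim(E^1_{x_1}\cap\cdots\cap E^d_{x_d}\cap F_{x_{d+1}})=\mathrm{rk}\,P[x_1,\dots,x_{d+1}]\quad\text{for all }F_\bullet\in X\text{ and all }1\le x_1,\dots,x_{d+1}\le n,$$ and let $P_1,\dots,P_n$ be its floors. Suppose $P_n$ is the transversal permutation array, and identify it with the set $T_{n,d}$. If, for some $k$, the rank of $P_k\cap P_n$ in the matroid $\mathcal{T}_{n,d}$ is greater than $k$, then $X=\emptyset$ and $c_{w^1\cdots w^d}=0$.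
   Context: Flags and Schubert varieties. A complete flag $E_\bullet$ in $\mathbb{C}^n$ is a chain $\{0\}=E_0\subset E_1\subset\cdots\subset E_n=\mathbb{C}^n$ with $\dim E_i=i$; $\mathcal{F}\ell_n$ is the variety of complete flags. To $w\in S_n$ associate the $n\times n$ matrix with a $1$ in row $w(i)$ of column $n-i+1$ for $1\le i\le n$ and $0$ elsewhere; $\mathrm{rk}\,w[i,j]$ is the rank of the submatrix formed by rows $1,\dots,i$ and columns $1,\dots,j$. The Schubert variety is $X_w(E_\bullet)=\{F_\bullet\in\mathcal{F}\ell_n:\dim(E_i\cap F_j)\ge\mathrm{rk}\,w[i,j]\text{ for all }1\le i,j\le n\}$. $\ell(w)$ is the number of inversions of $w$. "Generic" means: for all $(E^1_\bullet,\dots,E^d_\bullet)$ in some nonempty Zariski-open subset of $(\mathcal{F}\ell_n)^d$. When $\sum\ell(w^i)=\binom n2$, for generic flags the intersection $X$ is finite and its number of points depends only on $w^1,\dots,w^d$; it is denoted $c_{w^1\cdots w^d}$. Permutation arrays (Eriksson–Linusson). A dot array of shape $[n]^m$ is a subset $P\subseteq[n]^m$, whose elements are called dots. For $x\in[n]^m$, $P[x]=\{y\in P:y_i\le x_i\ \forall i\}$. A dot array is rankable of rank $r$ if for every $j\in\{1,\dots,m\}$ exactly $r$ distinct values occur as $j$-th coordinates of its dots; $\mathrm{rk}$ denotes this number. $P$ is totally rankable if $P[x]$ is rankable for every $x\in[n]^m$; its rank array is then $x\mapsto\mathrm{rk}\,P[x]$. A dot $y\in P$ is redundant if $P\setminus\{y\}$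 is also totally rankable with the same rank array. A permutation array of shape $[n]^m$ is a totally rankable dot array with no redundant dots; it is determined by its rank array. The array $P\subseteq[n]^{d+1}$ in the claim has rank $n$. Its $k$-th floor $P_k$ ($1\le k\le n$, corresponding to $F_k$) is the permutation array of shape $[n]^d$ (of rank $k$) with $\mathrm{rk}\,P_k[x_1,\dots,x_d]=\mathrm{rk}\,P[x_1,\dots,x_d,k]$ for all $x\in[n]^d$. The transversal permutation array is $\{x\in[n]^d: x_1+\cdots+x_d=(d-1)n+1\}$. Matroid. $T_{n,d}=\{y\in\mathbb{Z}_{\ge0}^d:y_1+\cdots+y_d=n-1\}$, identified with the transversal permutation array via $(x_1,\dots,x_d)\mapsto(n-x_1,\dots,n-x_d)$. $\mathcal{T}_{n,d}$ is the matroid on $T_{n,d}$ whose independent sets are the subsets $I$ such that, for every $1\le k\le n$ and all $a\in\mathbb{Z}_{\ge0}^d$ with $\sum a_i=n-k$, the set $\{y\in T_{n,d}:y_i\ge a_i\ \forall i\}$ contains at most $k$ points of $I$. *)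

theory Defs
  imports
    "HOL-Analysis.Analysis"
    "HOL-Combinatorics.Permutations"
    "Jordan_Normal_Form.DL_Rank"
    "Jordan_Normal_Form.DL_Submatrix"
begin

text \<open>
  The ambient space \<open>\<complex>\<^sup>n\<close> is \<open>complex ^ 'n\<close> with \<open>n = CARD('n)\<close>; \<open>vec.subspace\<close>, \<open>vec.dim\<close>,
  \<open>vec.span\<close> are the notions of linear algebra over the field \<open>complex\<close> (not over the reals).
  Flags, tuples of flags and dots are functions on \<open>nat\<close> that are \<open>undefined\<close> outside their
  index set (\<open>{0..n}\<close> for a flag, \<open>{1..m}\<close> for an \<open>m\<close>-tuple), so that equality, finiteness and
  cardinality are meaningful.
\<close>

section \<open>Flags and Schubert varieties\<close>

type_synonym 'n flag = "nat \<Rightarrow> (complex ^ 'n) set"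

definition complete_flags :: "'n::finite flag set" where
  "complete_flags =
    {E \<in> extensional {0..CARD('n)}.
       E 0 = {0} \<and> E CARD('n) = UNIV \<and>
       (\<forall>i\<in>{0..CARD('n)}. vec.subspace (E i) \<and> vec.dim (E i) = i) \<and>
       (\<forall>i<CARD('n). E i \<subset> E (Suc i))}"

definition flag_tuples :: "nat \<Rightarrow> (nat \<Rightarrow> 'n::finite flag) set" where
  "flag_tuples d = {1..d} \<rightarrow>\<^sub>E complete_flags"

text \<open>
  The matrix of \<open>w\<close> has its entry 1 of column \<open>n - i + 1\<close> in row \<open>w i\<close>. Matrices of type \<open>mat\<close> are
  indexed from 0, so position \<open>(r, c)\<close> below is row \<open>r + 1\<close> and column \<open>c + 1 = n - i + 1\<close>
  with \<open>i = n - c\<close>.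
\<close>

definition schubert_matrix :: "nat \<Rightarrow> (nat \<Rightarrow> nat) \<Rightarrow> complex mat" where
  "schubert_matrix n w = mat n n (\<lambda>(r, c). if r + 1 = w (n - c) then 1 else 0)"

definition schubert_rank :: "nat \<Rightarrow> (nat \<Rightarrow> nat) \<Rightarrow> nat \<Rightarrow> nat \<Rightarrow> nat" where
  "schubert_rank n w i j = vec_space.rank i (submatrix (schubert_matrix n w) {0..<i} {0..<j})"

definition schubert_variety :: "(nat \<Rightarrow> nat) \<Rightarrow> 'n::finite flag \<Rightarrow> 'n flag set" where
  "schubert_variety w E =
    {F \<in> complete_flags. \<forall>i\<in>{1..CARD('n)}. \<forall>j\<in>{1..CARD('n)}.
       vec.dim (E i \<inter> F j) \<ge> schubert_rank CARD('n) w i j}"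

definition schubert_intersection ::
    "nat \<Rightarrow> (nat \<Rightarrow> nat \<Rightarrow> nat) \<Rightarrow> (nat \<Rightarrow> 'n::finite flag) \<Rightarrow> 'n flag set" where
  "schubert_intersection d w E = complete_flags \<inter> (\<Inter>i\<in>{1..d}. schubert_variety (w i) (E i))"

definition perm_length :: "nat \<Rightarrow> (nat \<Rightarrow> nat) \<Rightarrow> nat" where
  "perm_length n w = card {(i, j). 1 \<le> i \<and> i < j \<and> j \<le> n \<and> w i > w j}"


section \<open>The Zariski topology on tuples of flags\<close>

text \<open>
  The flag variety is the quotient of \<open>GL\<^sub>n\<close> by the Borel subgroup: an ordered basis
  \<open>b 1, \<dots>, b n\<close> is sent to the flag of the spans of its initial segments. The quotient map is
  open, so a set of \<open>d\<close>-tuples of flags is Zariski open iff its preimage among the \<open>d\<close>-tuples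
  of ordered bases is Zariski open, i.e. is there the set where at least one of a family of
  polynomials in the coordinates \<open>b i j $ a\<close> does not vanish.
\<close>

type_synonym 'n basis_tuple = "nat \<Rightarrow> nat \<Rightarrow> complex ^ 'n"

definition ordered_basis :: "(nat \<Rightarrow> complex ^ 'n::finite) \<Rightarrow> bool" where
  "ordered_basis b \<longleftrightarrow>
    inj_on b {1..CARD('n)} \<and> vec.independent (b ` {1..CARD('n)}) \<and> vec.span (b ` {1..CARD('n)}) = UNIV"

definition flag_of :: "(nat \<Rightarrow> complex ^ 'n::finite) \<Rightarrow> 'n flag" where
  "flag_of b = (\<lambda>i\<in>{0..CARD('n)}. vec.span (b ` {1..i}))"

inductive_set poly_funs :: "nat \<Rightarrow> ('n::finite basis_tuple \<Rightarrow> complex) set" for d :: nat where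
  const: "(\<lambda>b. c) \<in> poly_funs d"
| coord: "i \<in> {1..d} \<Longrightarrow> j \<in> {1..CARD('n)} \<Longrightarrow> (\<lambda>b :: 'n basis_tuple. vec_nth (b i j) a) \<in> poly_funs d"
| add: "p \<in> poly_funs d \<Longrightarrow> q \<in> poly_funs d \<Longrightarrow> (\<lambda>b. p b + q b) \<in> poly_funs d"
| mult: "p \<in> poly_funs d \<Longrightarrow> q \<in> poly_funs d \<Longrightarrow> (\<lambda>b. p b * q b) \<in> poly_funs d"

definition zariski_open :: "nat \<Rightarrow> (nat \<Rightarrow> 'n::finite flag) set \<Rightarrow> bool" where
  "zariski_open d U \<longleftrightarrow> U \<subseteq> flag_tuples d \<and>
    (\<exists>S \<subseteq> poly_funs d. \<forall>b. (\<forall>i\<in>{1..d}. ordered_basis (b i)) \<longrightarrow>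
       ((\<lambda>i\<in>{1..d}. flag_of (b i)) \<in> U \<longleftrightarrow> (\<exists>p\<in>S. p b \<noteq> 0)))"

definition generically :: "nat \<Rightarrow> ((nat \<Rightarrow> 'n::finite flag) \<Rightarrow> bool) \<Rightarrow> bool" where
  "generically d Q \<longleftrightarrow> (\<exists>U. zariski_open d U \<and> U \<noteq> {} \<and> (\<forall>E\<in>U. Q E))"

text \<open>
  The number \<open>c\<close> attached to \<open>w 1, \<dots>, w d\<close>. The flag variety is irreducible, so at most one value
  is attained generically. The first argument only carries the dimension.
\<close>

definition schubert_number :: "'n::finite itself \<Rightarrow> nat \<Rightarrow> (nat \<Rightarrow> nat \<Rightarrow> nat) \<Rightarrow> nat" where
  "schubert_number _ d w =
    (THE c. generically d (\<lambda>E :: nat \<Rightarrow> 'n flag.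
       finite (schubert_intersection d w E) \<and> card (schubert_intersection d w E) = c))"


section \<open>Permutation arrays\<close>

type_synonym dots = "(nat \<Rightarrow> nat) set"

definition grid :: "nat \<Rightarrow> nat \<Rightarrow> dots" where
  "grid n m = {1..m} \<rightarrow>\<^sub>E {1..n}"

definition principal :: "nat \<Rightarrow> dots \<Rightarrow> (nat \<Rightarrow> nat) \<Rightarrow> dots" where
  "principal m P x = {y \<in> P. \<forall>j\<in>{1..m}. y j \<le> x j}"

definition has_rank :: "nat \<Rightarrow> dots \<Rightarrow> nat \<Rightarrow> bool" where
  "has_rank m P r \<longleftrightarrow> (\<forall>j\<in>{1..m}. card ((\<lambda>y. y j) ` P) = r)"

definition rankable :: "nat \<Rightarrow> dots \<Rightarrow> bool" where
  "rankable m P \<longleftrightarrow> (\<exists>r. has_rank m P r)"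

definition array_rank :: "nat \<Rightarrow> dots \<Rightarrow> nat" where
  "array_rank m P = (THE r. has_rank m P r)"

definition totally_rankable :: "nat \<Rightarrow> nat \<Rightarrow> dots \<Rightarrow> bool" where
  "totally_rankable n m P \<longleftrightarrow> (\<forall>x\<in>grid n m. rankable m (principal m P x))"

definition redundant :: "nat \<Rightarrow> nat \<Rightarrow> dots \<Rightarrow> (nat \<Rightarrow> nat) \<Rightarrow> bool" where
  "redundant n m P y \<longleftrightarrow> y \<in> P \<and> totally_rankable n m (P - {y}) \<and>
    (\<forall>x\<in>grid n m. array_rank m (principal m (P - {y}) x) = array_rank m (principal m P x))"

definition permutation_array :: "nat \<Rightarrow> nat \<Rightarrow> dots \<Rightarrow> bool" where
  "permutation_array n m P \<longleftrightarrow>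
    P \<subseteq> grid n m \<and> totally_rankable n m P \<and> (\<forall>y\<in>P. \<not> redundant n m P y)"

text \<open>
  A permutation array is determined by its rank array, so this relation determines the \<open>k\<close>-th
  floor \<open>Q\<close> of \<open>P\<close>.
\<close>

definition is_floor :: "nat \<Rightarrow> nat \<Rightarrow> dots \<Rightarrow> nat \<Rightarrow> dots \<Rightarrow> bool" where
  "is_floor n d P k Q \<longleftrightarrow> permutation_array n d Q \<and> has_rank d Q k \<and>
    (\<forall>x\<in>grid n d. array_rank d (principal d Q x) =
                   array_rank (d + 1) (principal (d + 1) P (x(d + 1 := k))))"

definition transversal_array :: "nat \<Rightarrow> nat \<Rightarrow> dots" where
  "transversal_array n d =
    {x \<in> grid n d. int (\<Sum>i\<in>{1..d}. x i) = (int d - 1) * int n + 1}"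

definition describes_dimensions ::
    "nat \<Rightarrow> dots \<Rightarrow> (nat \<Rightarrow> 'n::finite flag) \<Rightarrow> 'n flag \<Rightarrow> bool" where
  "describes_dimensions d P E F \<longleftrightarrow>
    (\<forall>x\<in>grid CARD('n) (d + 1).
       vec.dim ((\<Inter>i\<in>{1..d}. E i (x i)) \<inter> F (x (d + 1))) = array_rank (d + 1) (principal (d + 1) P x))"


section \<open>The matroid on \<open>T n d\<close>\<close>

definition T_points :: "nat \<Rightarrow> nat \<Rightarrow> dots" where
  "T_points n d = {y \<in> {1..d} \<rightarrow>\<^sub>E UNIV. (\<Sum>i\<in>{1..d}. y i) = n - 1}"

definition to_T :: "nat \<Rightarrow> nat \<Rightarrow> (nat \<Rightarrow> nat) \<Rightarrow> (nat \<Rightarrow> nat)" where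
  "to_T n d x = (\<lambda>i\<in>{1..d}. n - x i)"

definition T_indep :: "nat \<Rightarrow> nat \<Rightarrow> dots \<Rightarrow> bool" where
  "T_indep n d I \<longleftrightarrow> I \<subseteq> T_points n d \<and>
    (\<forall>k\<in>{1..n}. \<forall>a :: nat \<Rightarrow> nat. (\<Sum>i\<in>{1..d}. a i) = n - k \<longrightarrow>
       card (I \<inter> {y \<in> T_points n d. \<forall>i\<in>{1..d}. y i \<ge> a i}) \<le> k)"

definition T_rank :: "nat \<Rightarrow> nat \<Rightarrow> dots \<Rightarrow> nat" where
  "T_rank n d S = Max (card ` {I. I \<subseteq> S \<and> T_indep n d I})"

end

theory Submission
  imports Defs "HOL-Computational_Algebra.Polynomial"
begin

text \<open>
  If \<open>I\<close> is independent in the matroid, then for generic flags the spaces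
  \<open>\<Inter>i. E i (n - y i)\<close>, \<open>y \<in> I\<close>, are linearly independent lines. It suffices to find one such tuple
  of flags. Cut \<open>E i\<close> out by successive hyperplanes \<open>h i 1, \<dots>, h i (n - 1)\<close> and ask the
  line of \<open>y\<close> to be spanned by a basis vector \<open>e y\<close>: then \<open>h i j\<close> must not involve the
  coordinates \<open>e z\<close> with \<open>z i \<ge> j\<close>. Functionals that are generic with these supports work, since
  the bound on \<open>card {z \<in> I. a \<le> z}\<close> in the definition of the matroid is the condition in Hall's
  theorem for the relevant minors not to vanish identically.
  A dot of \<open>P_floor k\<close> forces its line to lie in \<open>F k\<close>, so more than \<open>k\<close> independent dots
  contradict \<open>dim (F k) = k\<close>.
\<close>

section \<open>Polynomial conditions on tuples of bases\<close>

lemma poly_funs_uminus: "p \<in> poly_funs d \<Longrightarrow> (\<lambda>b. - p b) \<in> poly_funs d"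
  using poly_funs.mult[OF poly_funs.const[of "- 1"], of p d] by simp

lemma poly_funs_diff:
  "p \<in> poly_funs d \<Longrightarrow> q \<in> poly_funs d \<Longrightarrow> (\<lambda>b. p b - q b) \<in> poly_funs d"
  using poly_funs.add[OF _ poly_funs_uminus, of p d q] by simp

lemma poly_funs_sum:
  "(\<And>x. x \<in> A \<Longrightarrow> f x \<in> poly_funs d) \<Longrightarrow> (\<lambda>b. \<Sum>x\<in>A. f x b) \<in> poly_funs d"
  by (induction A rule: infinite_finite_induct) (auto intro: poly_funs.intros)

lemma poly_funs_compose:
  fixes g :: "'n::finite basis_tuple \<Rightarrow> 'n basis_tuple"
  assumes "p \<in> poly_funs d"
    and "\<And>i j a. i \<in> {1..d} \<Longrightarrow> j \<in> {1..CARD('n)} \<Longrightarrow> (\<lambda>b. vec_nth (g b i j) a) \<in> poly_funs d"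
  shows "(\<lambda>b. p (g b)) \<in> poly_funs d"
  using assms(1) by induction (auto intro: poly_funs.intros assms(2))

lemma poly_funs_cong:
  fixes b b' :: "'n::finite basis_tuple"
  assumes "p \<in> poly_funs d"
    and "\<And>i j. i \<in> {1..d} \<Longrightarrow> j \<in> {1..CARD('n)} \<Longrightarrow> b i j = b' i j"
  shows "p b = p b'"
  using assms(1) by induction (auto simp: assms(2))

text \<open>Restriction to a line gives a polynomial in one variable, which has only finitely many
  roots unless it is zero.\<close>

lemma poly_funs_on_line:
  assumes "p \<in> poly_funs d"
  shows "\<exists>P. \<forall>t. poly P t = p (\<lambda>i j. b i j + t *s c i j)"
  using assms
proof induction
  case (const k)
  show ?case by (rule exI[of _ "[:k:]"]) simp
next
  case (coord i j a)
  show ?case by (rule exI[of _ "[:vec_nth (b i j) a, vec_nth (c i j) a:]"]) (simp add: algebra_simps)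
next
  case (add p q)
  then obtain P Q where "\<forall>t. poly P t = p (\<lambda>i j. b i j + t *s c i j)"
    "\<forall>t. poly Q t = q (\<lambda>i j. b i j + t *s c i j)" by blast
  then show ?case by (intro exI[of _ "P + Q"]) simp
next
  case (mult p q)
  then obtain P Q where "\<forall>t. poly P t = p (\<lambda>i j. b i j + t *s c i j)"
    "\<forall>t. poly Q t = q (\<lambda>i j. b i j + t *s c i j)" by blast
  then show ?case by (intro exI[of _ "P * Q"]) simp
qed

section \<open>Zariski open conditions and irreducibility of the parameter space\<close>

text \<open>Openness in the affine space of all tuples of vectors, bases or not, stated pointwise
  through principal open neighbourhoods. In this larger space any two points are joined by a line of
  parameters.\<close>

definition basis_open :: "nat \<Rightarrow> ('n::finite basis_tuple \<Rightarrow> bool) \<Rightarrow> bool" where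
  "basis_open d C \<longleftrightarrow>
    (\<forall>b0. C b0 \<longrightarrow> (\<exists>p\<in>poly_funs d. p b0 \<noteq> 0 \<and> (\<forall>b. p b \<noteq> 0 \<longrightarrow> C b)))"

lemma basis_openE:
  assumes "basis_open d C" "C b0"
  obtains p where "p \<in> poly_funs d" "p b0 \<noteq> 0" "\<And>b. p b \<noteq> 0 \<Longrightarrow> C b"
  using assms unfolding basis_open_def by auto

lemma basis_openI:
  assumes "\<And>b0. C b0 \<Longrightarrow> \<exists>p\<in>poly_funs d. p b0 \<noteq> 0 \<and> (\<forall>b. p b \<noteq> 0 \<longrightarrow> C b)"
  shows "basis_open d C"
  using assms unfolding basis_open_def by simp

lemma basis_open_nonzero: "p \<in> poly_funs d \<Longrightarrow> basis_open d (\<lambda>b. p b \<noteq> 0)"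
  unfolding basis_open_def by blast

lemma basis_open_True: "basis_open d (\<lambda>b. True)"
  using basis_open_nonzero[OF poly_funs.const[of 1 d]] by simp

lemma basis_open_conj:
  assumes "basis_open d C" "basis_open d D"
  shows "basis_open d (\<lambda>b. C b \<and> D b)"
proof (rule basis_openI)
  fix b0 assume b0: "C b0 \<and> D b0"
  obtain p where p: "p \<in> poly_funs d" "p b0 \<noteq> 0" "\<And>b. p b \<noteq> 0 \<Longrightarrow> C b"
    using basis_openE[OF assms(1)] b0 by metis
  obtain q where q: "q \<in> poly_funs d" "q b0 \<noteq> 0" "\<And>b. q b \<noteq> 0 \<Longrightarrow> D b"
    using basis_openE[OF assms(2)] b0 by metis
  show "\<exists>p\<in>poly_funs d. p b0 \<noteq> 0 \<and> (\<forall>b. p b \<noteq> 0 \<longrightarrow> C b \<and> D b)"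
    by (rule bexI[OF _ poly_funs.mult[OF p(1) q(1)]]) (use p q in simp)
qed

lemma basis_open_ball:
  assumes "finite T" "\<And>t. t \<in> T \<Longrightarrow> basis_open d (C t)"
  shows "basis_open d (\<lambda>b. \<forall>t\<in>T. C t b)"
  using assms by (induction T rule: finite_induct) (auto intro: basis_open_True basis_open_conj)

text \<open>Irreducibility of affine space: on the line joining the two witnesses each of the two
  polynomials is nonzero somewhere, so their product has only finitely many roots.\<close>

lemma basis_open_meet:
  fixes b1 b2 :: "'n::finite basis_tuple"
  assumes "basis_open d C" "C b1" "basis_open d D" "D b2"
  shows "\<exists>b. C b \<and> D b"
proof -
  obtain p where p: "p \<in> poly_funs d" "p b1 \<noteq> 0" "\<And>b. p b \<noteq> 0 \<Longrightarrow> C b"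
    using basis_openE[OF assms(1,2)] by blast
  obtain q where q: "q \<in> poly_funs d" "q b2 \<noteq> 0" "\<And>b. q b \<noteq> 0 \<Longrightarrow> D b"
    using basis_openE[OF assms(3,4)] by blast
  let ?line = "\<lambda>t. (\<lambda>i j. b1 i j + t *s (b2 i j - b1 i j))"
  obtain P Q where PQ: "\<And>t. poly P t = p (?line t)" "\<And>t. poly Q t = q (?line t)"
    using poly_funs_on_line[OF p(1)] poly_funs_on_line[OF q(1)] by meson
  have "?line 0 = b1" "?line 1 = b2" by (auto simp: vec.scale_left_distrib)
  with PQ p(2) q(2) have "poly P 0 \<noteq> 0" "poly Q 1 \<noteq> 0" by auto
  then have "P * Q \<noteq> 0" by auto
  then have "finite {t. poly (P * Q) t = 0}" by (rule poly_roots_finite)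
  then obtain t where "poly (P * Q) t \<noteq> 0"
    using ex_new_if_finite[OF infinite_UNIV_char_0] by blast
  then have "p (?line t) \<noteq> 0" "q (?line t) \<noteq> 0" using PQ by auto
  then have "C (?line t) \<and> D (?line t)" using p(3) q(3) by blast
  then show ?thesis by (intro exI[of _ "?line t"])
qed

text \<open>Each condition may bring its own witness; irreducibility supplies a common one.\<close>

lemma basis_open_meet_finite:
  assumes "finite T" "\<And>t. t \<in> T \<Longrightarrow> basis_open d (C t)" "\<And>t. t \<in> T \<Longrightarrow> \<exists>b. C t b"
  shows "\<exists>b. \<forall>t\<in>T. C t b"
  using assms
proof (induction T rule: finite_induct)
  case (insert t T)
  obtain b1 b2 where "C t b1" "\<forall>t\<in>T. C t b2" using insert by blast
  with basis_open_meet[of d "C t" b1 "\<lambda>b. \<forall>t\<in>T. C t b" b2] insert show ?case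
    by (auto intro!: basis_open_ball)
qed simp

text \<open>Gaussian elimination: clearing the column \<open>s0\<close> with a pivot row \<open>r0\<close> without
  dividing keeps the entries polynomial and preserves injectivity as long as the pivot does not
  vanish.\<close>

lemma basis_open_injective:
  fixes a :: "'r \<Rightarrow> 's \<Rightarrow> 'n::finite basis_tuple \<Rightarrow> complex"
  assumes "finite S" "\<And>r s. r \<in> R \<Longrightarrow> s \<in> S \<Longrightarrow> a r s \<in> poly_funs d"
  shows "basis_open d
    (\<lambda>b. \<forall>c. (\<forall>r\<in>R. (\<Sum>s\<in>S. a r s b * c s) = 0) \<longrightarrow> (\<forall>s\<in>S. c s = 0))"
  using assms
proof (induction S arbitrary: a rule: finite_induct)
  case empty
  then show ?case by (simp add: basis_open_True)
next
  case (insert s0 S)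
  define inj where "inj S a b \<longleftrightarrow>
      (\<forall>c. (\<forall>r\<in>R. (\<Sum>s\<in>S. a r s b * c s) = 0) \<longrightarrow> (\<forall>s\<in>S. c s = 0))"
    for S and a :: "'r \<Rightarrow> 's \<Rightarrow> 'n basis_tuple \<Rightarrow> complex" and b
  have "basis_open d (inj (insert s0 S) a)"
  proof (rule basis_openI)
    fix b0 assume b0: "inj (insert s0 S) a b0"
    \<comment> \<open>If the column \<open>s0\<close> were zero at \<open>b0\<close>, the unit
      vector at \<open>s0\<close> would lie in the kernel.\<close>
    obtain r0 where r0: "r0 \<in> R" "a r0 s0 b0 \<noteq> 0"
    proof (rule ccontr)
      assume "\<not> thesis"
      with that have "\<forall>r\<in>R. a r s0 b0 = 0" by blast
      with insert.hyps have "\<forall>r\<in>R. (\<Sum>s\<in>insert s0 S. a r s b0 * (if s = s0 then 1 else 0)) = 0"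
        by (auto intro!: sum.neutral)
      with b0 show False unfolding inj_def by (auto dest!: spec[of _ "\<lambda>s. if s = s0 then 1 else 0"])
    qed
    define a' where "a' r s b = a r0 s0 b * a r s b - a r s0 b * a r0 s b" for r s b
    have expand: "(\<Sum>s\<in>S. a' r s b * c s) =
        a r0 s0 b * (\<Sum>s\<in>S. a r s b * c s) - a r s0 b * (\<Sum>s\<in>S. a r0 s b * c s)" for r b c
      unfolding a'_def by (simp add: sum_distrib_left sum_subtractf[symmetric] algebra_simps)
    have iff: "inj (insert s0 S) a b \<longleftrightarrow> inj S a' b" if pivot: "a r0 s0 b \<noteq> 0" for b
    proof
      assume L: "inj (insert s0 S) a b"
      show "inj S a' b" unfolding inj_def
      proof (intro allI impI)
        fix c assume c: "\<forall>r\<in>R. (\<Sum>s\<in>S. a' r s b * c s) = 0"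
        \<comment> \<open>The new value at \<open>s0\<close> solves the equation of the pivot
          row.\<close>
        define c' where "c' = c(s0 := - (\<Sum>s\<in>S. a r0 s b * c s) / a r0 s0 b)"
        have S: "(\<Sum>s\<in>S. a r s b * c' s) = (\<Sum>s\<in>S. a r s b * c s)" for r
          unfolding c'_def using insert.hyps by (intro sum.cong) auto
        have "(\<Sum>s\<in>insert s0 S. a r s b * c' s) = 0" if "r \<in> R" for r
        proof -
          have "a r0 s0 b * (\<Sum>s\<in>insert s0 S. a r s b * c' s) = (\<Sum>s\<in>S. a' r s b * c s)"
            using insert.hyps pivot unfolding expand
            by (simp add: S) (simp add: c'_def field_simps)
          with c that pivot show ?thesis by simp
        qed
        with L have "\<forall>s\<in>S. c' s = 0" unfolding inj_def by blast
        with insert.hyps show "\<forall>s\<in>S. c s = 0" unfolding c'_def by (metis fun_upd_other)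
      qed
    next
      assume L: "inj S a' b"
      show "inj (insert s0 S) a b" unfolding inj_def
      proof (intro allI impI)
        fix c assume c: "\<forall>r\<in>R. (\<Sum>s\<in>insert s0 S. a r s b * c s) = 0"
        then have eq: "(\<Sum>s\<in>S. a r s b * c s) = - a r s0 b * c s0" if "r \<in> R" for r
          using insert.hyps that by (simp add: eq_neg_iff_add_eq_0 add.commute)
        have "\<forall>r\<in>R. (\<Sum>s\<in>S. a' r s b * c s) = 0"
          unfolding expand using eq r0(1) by (simp add: algebra_simps)
        with L have S: "\<forall>s\<in>S. c s = 0" unfolding inj_def by blast
        then have "a r0 s0 b * c s0 = 0" using eq[OF r0(1)] by simp
        with pivot S show "\<forall>s\<in>insert s0 S. c s = 0" by simp
      qed
    qed
    have "a' r s \<in> poly_funs d" if "r \<in> R" "s \<in> S" for r s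
      unfolding a'_def using that r0(1) insert.prems
      by (intro poly_funs_diff poly_funs.mult) auto
    from insert.IH[OF this] have "basis_open d (inj S a')" unfolding inj_def by simp
    note IH = basis_openE[OF this, of b0]
    have "inj S a' b0" using iff[OF r0(2)] b0 by simp
    then obtain p where
      p: "p \<in> poly_funs d" "p b0 \<noteq> 0" "\<And>b. p b \<noteq> 0 \<Longrightarrow> inj S a' b"
      using IH by blast
    \<comment> \<open>The pivot entry becomes a factor of the polynomial, so that \<open>iff\<close>
      applies wherever the product is nonzero.\<close>
    have "a r0 s0 \<in> poly_funs d" using insert.prems r0(1) by simp
    then show "\<exists>p\<in>poly_funs d. p b0 \<noteq> 0 \<and> (\<forall>b. p b \<noteq> 0 \<longrightarrow> inj (insert s0 S) a b)"
      by (intro bexI[OF _ poly_funs.mult[OF p(1)]]) (use p r0 iff in simp_all)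
  qed
  then show ?case unfolding inj_def .
qed

section \<open>Hall's theorem\<close>

text \<open>Induction on \<open>card J\<close>. If a proper nonempty subfamily is tight, it is
  matched first and the remaining sets lose its union. Otherwise every proper nonempty subfamily has
  an element to spare, so one set can be given any of its elements.\<close>

lemma hall:
  fixes A :: "'j \<Rightarrow> 'a set"
  assumes "finite J" "\<And>s. s \<in> J \<Longrightarrow> finite (A s)"
    and "\<And>K. K \<subseteq> J \<Longrightarrow> card K \<le> card (\<Union>s\<in>K. A s)"
  shows "\<exists>m. inj_on m J \<and> (\<forall>s\<in>J. m s \<in> A s)"
  using assms
proof (induction "card J" arbitrary: J A rule: less_induct)
  case less
  show ?case
  proof (cases "J = {}")
    case False
    show ?thesis
    proof (cases "\<exists>K. K \<subset> J \<and> K \<noteq> {} \<and> card K = card (\<Union>s\<in>K. A s)")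
      case True
      then obtain K where K: "K \<subset> J" "K \<noteq> {}" "card K = card (\<Union>s\<in>K. A s)" by blast
      define U where "U = (\<Union>s\<in>K. A s)"
      have finK: "finite K" using K less.prems(1) finite_subset by blast
      have finU: "finite U" unfolding U_def using finK K less.prems(2) by blast
      have "\<exists>m. inj_on m K \<and> (\<forall>s\<in>K. m s \<in> A s)"
      proof (rule less.hyps)
        show "card K < card J" using K(1) less.prems(1) by (rule psubset_card_mono[rotated])
        show "card L \<le> card (\<Union>s\<in>L. A s)" if "L \<subseteq> K" for L
          using that K(1) by (intro less.prems(3)) blast
      qed (use K(1) finK less.prems(2) in blast)+
      then obtain m1 where m1: "inj_on m1 K" "\<forall>s\<in>K. m1 s \<in> A s" by blast
      have "\<exists>m. inj_on m (J - K) \<and> (\<forall>s\<in>J - K. m s \<in> A s - U)"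
      proof (rule less.hyps)
        show "card (J - K) < card J"
          using K less.prems(1) by (intro psubset_card_mono) auto
        fix L assume L: "L \<subseteq> J - K"
        have finL: "finite L" using L less.prems(1) finite_subset by blast
        \<comment> \<open>Hall's condition for \<open>L \<union> K\<close>, less the tight equality
          for \<open>K\<close>, is Hall's condition for \<open>L\<close> outside
          \<open>U\<close>.\<close>
        have "card L + card K = card (L \<union> K)"
          using L finL finK by (subst card_Un_disjoint) auto
        also have "\<dots> \<le> card (\<Union>s\<in>L \<union> K. A s)" using L K by (intro less.prems(3)) auto
        also have "(\<Union>s\<in>L \<union> K. A s) = (\<Union>s\<in>L. A s - U) \<union> U" unfolding U_def by auto
        also have "card \<dots> \<le> card (\<Union>s\<in>L. A s - U) + card U" by (rule card_Un_le)
        finally show "card L \<le> card (\<Union>s\<in>L. A s - U)" using K(3) U_def by simp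
      qed (use less.prems(1,2) in auto)
      then obtain m2 where m2: "inj_on m2 (J - K)" "\<forall>s\<in>J - K. m2 s \<in> A s - U" by blast
      define m where "m s = (if s \<in> K then m1 s else m2 s)" for s
      have "inj_on m J"
      proof (rule inj_onI)
        fix s t assume "s \<in> J" "t \<in> J" "m s = m t"
        moreover have "m1 u \<in> U" if "u \<in> K" for u using m1 that unfolding U_def by blast
        moreover have "m2 u \<notin> U" if "u \<in> J - K" for u using m2(2) that by blast
        ultimately show "s = t" using inj_onD[OF m1(1)] inj_onD[OF m2(1)] unfolding m_def
          by (metis DiffI)
      qed
      moreover have "\<forall>s\<in>J. m s \<in> A s" using m1(2) m2(2) unfolding m_def by simp
      ultimately show ?thesis by blast
    next
      case tight: False
      obtain s where s: "s \<in> J" using False by blast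
      have "card {s} \<le> card (\<Union>s\<in>{s}. A s)" using s by (intro less.prems(3)) auto
      then have "A s \<noteq> {}" by auto
      then obtain x where x: "x \<in> A s" by blast
      have "\<exists>m. inj_on m (J - {s}) \<and> (\<forall>t\<in>J - {s}. m t \<in> A t - {x})"
      proof (rule less.hyps)
        show "card (J - {s}) < card J" using s less.prems(1) by (meson card_Diff1_less)
        fix K assume K: "K \<subseteq> J - {s}"
        show "card K \<le> card (\<Union>t\<in>K. A t - {x})"
        proof (cases "K = {}")
          case False
          \<comment> \<open>Without tight subfamilies the inequality is strict, which pays for
            deleting \<open>x\<close>.\<close>
          have "card K \<noteq> card (\<Union>t\<in>K. A t)" using tight K False s by blast
          moreover have "card K \<le> card (\<Union>t\<in>K. A t)" using K by (intro less.prems(3)) auto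
          moreover have "card (\<Union>t\<in>K. A t) - 1 \<le> card ((\<Union>t\<in>K. A t) - {x})"
            by (simp add: card_Diff_singleton_if)
          ultimately have "card K \<le> card ((\<Union>t\<in>K. A t) - {x})" by linarith
          also have "(\<Union>t\<in>K. A t) - {x} = (\<Union>t\<in>K. A t - {x})" by auto
          finally show ?thesis .
        qed simp
      qed (use less.prems(1,2) in auto)
      then obtain m where m: "inj_on m (J - {s})" "\<forall>t\<in>J - {s}. m t \<in> A t - {x}" by blast
      have "inj_on (m(s := x)) J"
      proof (rule inj_onI)
        fix t u assume "t \<in> J" "u \<in> J" "(m(s := x)) t = (m(s := x)) u"
        then show "t = u" using inj_onD[OF m(1), of t u] m(2) by (auto split: if_splits)
      qed
      moreover have "\<forall>t\<in>J. (m(s := x)) t \<in> A t" using m(2) x by simp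
      ultimately show ?thesis by blast
    qed
  qed simp
qed

section \<open>Flags and genericity\<close>

text \<open>The coefficients are attached to indices rather than to vectors, so repetitions among
  the \<open>b k\<close> are harmless.\<close>

lemma span_image_coeffs:
  fixes b :: "'k \<Rightarrow> complex ^ 'n"
  assumes "finite A" "v \<in> vec.span (b ` A)"
  shows "\<exists>c. v = (\<Sum>k\<in>A. c k *s b k)"
  using assms(2)
proof (induction rule: vec.span_induct_alt)
  case base
  show ?case by (rule exI[of _ "\<lambda>k. 0"]) simp
next
  case (step r x y)
  then obtain k c where k: "k \<in> A" "x = b k" and y: "y = (\<Sum>k\<in>A. c k *s b k)" by blast
  have "(\<Sum>j\<in>A. (c j + (if j = k then r else 0)) *s b j) =
      (\<Sum>j\<in>A. c j *s b j) + (\<Sum>j\<in>A. if j = k then r *s b j else 0)"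
    by (simp add: sum.distrib[symmetric] vec.scale_left_distrib if_distrib cong: if_cong)
      (auto intro!: sum.cong)
  also have "\<dots> = r *s x + y" using k y assms(1) by (simp add: add.commute)
  finally show ?case by metis
qed

lemma span_image_sum:
  fixes b :: "'k \<Rightarrow> complex ^ 'n"
  shows "(\<Sum>k\<in>A. c k *s b k) \<in> vec.span (b ` A)"
proof (rule vec.span_sum)
  show "c k *s b k \<in> vec.span (b ` A)" if "k \<in> A" for k
    using that by (intro vec.span_scale vec.span_base imageI)
qed

text \<open>Turns the basis condition into injectivity of the coordinate matrix, the form handled by
  \<open>basis_open_injective\<close>. Spanning follows from independence by counting
  dimensions.\<close>

lemma ordered_basis_iff:
  fixes b :: "nat \<Rightarrow> complex ^ 'n::finite"
  shows "ordered_basis b \<longleftrightarrow>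
    (\<forall>c. (\<Sum>k\<in>{1..CARD('n)}. c k *s b k) = 0 \<longrightarrow> (\<forall>k\<in>{1..CARD('n)}. c k = 0))"
    (is "_ \<longleftrightarrow> ?R")
proof
  assume b: "ordered_basis b"
  show ?R
  proof (intro allI impI ballI)
    fix c k assume c: "(\<Sum>k\<in>{1..CARD('n)}. c k *s b k) = 0" and k: "k \<in> {1..CARD('n)}"
    have inj: "inj_on b {1..CARD('n)}" using b unfolding ordered_basis_def by blast
    have "(\<Sum>v\<in>b ` {1..CARD('n)}. c (inv_into {1..CARD('n)} b v) *s v) = 0"
      using c by (simp add: sum.reindex[OF inj] inv_into_f_f[OF inj] del: One_nat_def)
    then have "c (inv_into {1..CARD('n)} b (b k)) = 0"
      using b k unfolding ordered_basis_def by (intro vec.independentD[of "b ` {1..CARD('n)}"]) auto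
    then show "c k = 0" using k by (simp add: inv_into_f_f[OF inj] del: One_nat_def)
  qed
next
  assume R: ?R
  have inj: "inj_on b {1..CARD('n)}"
  proof (rule inj_onI, rule ccontr)
    fix j k assume jk: "j \<in> {1..CARD('n)}" "k \<in> {1..CARD('n)}" "b j = b k" "j \<noteq> k"
    \<comment> \<open>Coefficients of the relation \<open>b j - b k = 0\<close>.\<close>
    define c :: "nat \<Rightarrow> complex" where "c i = (if i = j then 1 else if i = k then - 1 else 0)" for i
    have "(\<Sum>i\<in>{1..CARD('n)}. c i *s b i) = (\<Sum>i\<in>{j, k}. c i *s b i)"
      using jk by (intro sum.mono_neutral_right) (auto simp: c_def)
    also have "\<dots> = 0" using jk by (simp add: c_def)
    finally have "c j = 0" using R jk by blast
    then show False by (simp add: c_def)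
  qed
  have ind: "vec.independent (b ` {1..CARD('n)})"
  proof (rule vec.independent_if_scalars_zero)
    fix f x assume f: "(\<Sum>x\<in>b ` {1..CARD('n)}. f x *s x) = 0" and x: "x \<in> b ` {1..CARD('n)}"
    have "(\<Sum>k\<in>{1..CARD('n)}. f (b k) *s b k) = 0"
      using f by (simp add: sum.reindex[OF inj] del: One_nat_def)
    with R have "\<forall>k\<in>{1..CARD('n)}. f (b k) = 0" by (elim allE[of _ "\<lambda>k. f (b k)"]) blast
    with x show "f x = 0" by blast
  qed simp
  have "UNIV \<subseteq> vec.span (b ` {1..CARD('n)})"
    using ind vec_dim_card[where 'a = complex and 'n = 'n]
    by (intro vec.card_ge_dim_independent) (auto simp: card_image[OF inj] simp del: One_nat_def vec.dim_UNIV)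
  with inj ind show "ordered_basis b" unfolding ordered_basis_def by blast
qed

lemma basis_open_ordered_basis:
  assumes "i \<in> {1..d}"
  shows "basis_open d (\<lambda>b :: 'n::finite basis_tuple. ordered_basis (b i))"
proof -
  have "basis_open d (\<lambda>b :: 'n basis_tuple. \<forall>c. (\<forall>a\<in>UNIV. (\<Sum>k\<in>{1..CARD('n)}. vec_nth (b i k) a * c k) = 0)
      \<longrightarrow> (\<forall>k\<in>{1..CARD('n)}. c k = 0))"
    using assms by (intro basis_open_injective poly_funs.coord) auto
  then show ?thesis
    unfolding ordered_basis_iff by (simp add: Finite_Cartesian_Product.vec_eq_iff mult.commute)
qed

lemma dim_span_ordered_basis:
  fixes b :: "nat \<Rightarrow> complex ^ 'n::finite"
  assumes "ordered_basis b" "A \<subseteq> {1..CARD('n)}"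
  shows "vec.dim (vec.span (b ` A)) = card A"
proof -
  have "vec.independent (b ` A)" "inj_on b A"
    using assms unfolding ordered_basis_def
    by (meson vec.independent_mono image_mono) (use assms in \<open>auto simp: ordered_basis_def intro: inj_on_subset\<close>)
  then show ?thesis by (metis vec.dim_span_eq_card_independent card_image)
qed

lemma flag_of_complete:
  fixes b :: "nat \<Rightarrow> complex ^ 'n::finite"
  assumes "ordered_basis b"
  shows "flag_of b \<in> complete_flags"
proof -
  have dim: "vec.dim (vec.span (b ` {1..i})) = i" if "i \<le> CARD('n)" for i
    using dim_span_ordered_basis[OF assms, of "{1..i}"] that by simp
  have "vec.span (b ` {1..i}) \<subset> vec.span (b ` {1..Suc i})" if "i < CARD('n)" for i
  proof -
    have "vec.span (b ` {1..i}) \<subseteq> vec.span (b ` {1..Suc i})"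
      by (intro vec.span_mono image_mono) auto
    moreover have "vec.dim (vec.span (b ` {1..i})) \<noteq> vec.dim (vec.span (b ` {1..Suc i}))"
      unfolding dim[OF less_imp_le[OF that]] dim[OF Suc_leI[OF that]] by simp
    ultimately show ?thesis by (metis psubsetI)
  qed
  moreover have "vec.span (b ` {1..CARD('n)}) = UNIV" using assms unfolding ordered_basis_def by simp
  ultimately show ?thesis
    unfolding complete_flags_def flag_of_def using dim by simp
qed

text \<open>A triangular substitution gives inclusions between the initial spans, and equal
  dimensions make them equalities.\<close>

lemma flag_of_eqI:
  fixes b b' :: "nat \<Rightarrow> complex ^ 'n::finite"
  assumes "ordered_basis b" "ordered_basis b'"
    and "\<And>j. j \<in> {1..CARD('n)} \<Longrightarrow> b' j \<in> vec.span (b ` {1..j})"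
  shows "flag_of b' = flag_of b"
  unfolding flag_of_def
proof (rule restrict_ext)
  fix i assume i: "i \<in> {0..CARD('n)}"
  have "b' j \<in> vec.span (b ` {1..i})" if "j \<in> {1..i}" for j
  proof -
    have "vec.span (b ` {1..j}) \<subseteq> vec.span (b ` {1..i})"
      using that by (intro vec.span_mono image_mono) auto
    then show ?thesis using assms(3)[of j] that i by auto
  qed
  then have "vec.span (b' ` {1..i}) \<subseteq> vec.span (b ` {1..i})"
    by (intro vec.span_minimal) auto
  moreover have "vec.dim (vec.span (b ` {1..i})) = vec.dim (vec.span (b' ` {1..i}))"
    using dim_span_ordered_basis[OF assms(1), of "{1..i}"]
      dim_span_ordered_basis[OF assms(2), of "{1..i}"] i by simp
  ultimately show "vec.span (b' ` {1..i}) = vec.span (b ` {1..i})"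
    by (intro vec.subspace_dim_equal) auto
qed

text \<open>One vector is chosen in each difference \<open>E (Suc i) - E i\<close>. It is
  independent of the earlier ones, and dimensions identify the initial spans with the flag.\<close>

lemma complete_flag_basis:
  fixes E :: "'n::finite flag"
  assumes E: "E \<in> complete_flags"
  shows "\<exists>b. ordered_basis b \<and> flag_of b = E"
proof -
  have outside: "E \<in> extensional {0..CARD('n)}" and E0: "E 0 = {0}" and En: "E CARD('n) = UNIV"
    and sub: "\<And>i. i \<le> CARD('n) \<Longrightarrow> vec.subspace (E i)"
    and dim: "\<And>i. i \<le> CARD('n) \<Longrightarrow> vec.dim (E i) = i"
    and less: "\<And>i. i < CARD('n) \<Longrightarrow> E i \<subset> E (Suc i)"
    using E unfolding complete_flags_def by auto
  have "\<exists>v. v \<in> E (Suc i) \<and> v \<notin> E i" if "i < CARD('n)" for i using less[OF that] by blast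
  then obtain u where u: "\<And>i. i < CARD('n) \<Longrightarrow> u i \<in> E (Suc i) \<and> u i \<notin> E i" by metis
  \<comment> \<open>Shifted so that \<open>b (Suc i)\<close> is the vector chosen outside
    \<open>E i\<close>.\<close>
  define b where "b j = u (j - 1)" for j
  have key: "inj_on b {1..i} \<and> vec.independent (b ` {1..i}) \<and> vec.span (b ` {1..i}) = E i"
    if "i \<le> CARD('n)" for i
    using that
  proof (induction i)
    case 0
    then show ?case using E0 by (simp add: vec.independent_empty)
  next
    case (Suc i)
    then have IH: "inj_on b {1..i}" "vec.independent (b ` {1..i})" "vec.span (b ` {1..i}) = E i" by auto
    have b: "b (Suc i) \<in> E (Suc i)" "b (Suc i) \<notin> E i" using u[of i] Suc.prems by (auto simp: b_def)
    then have nin: "b (Suc i) \<notin> b ` {1..i}" using IH(3) vec.span_base[of "b (Suc i)" "b ` {1..i}"] by blast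
    have ins: "{1..Suc i} = insert (Suc i) {1..i}" by auto
    have inj: "inj_on b {1..Suc i}" unfolding ins using IH(1) nin by auto
    have ind: "vec.independent (b ` {1..Suc i})"
      unfolding ins image_insert using IH b(2) by (intro vec.independent_insertI) simp_all
    have "vec.span (b ` {1..i}) \<subseteq> E (Suc i)" using IH(3) less[of i] Suc.prems by auto
    then have "b ` {1..i} \<subseteq> E (Suc i)" using vec.span_superset[of "b ` {1..i}"] by blast
    then have "b ` {1..Suc i} \<subseteq> E (Suc i)" unfolding ins using b by auto
    then have "vec.span (b ` {1..Suc i}) \<subseteq> E (Suc i)"
      using Suc.prems by (intro vec.span_minimal sub) auto
    moreover have "vec.dim (vec.span (b ` {1..Suc i})) = Suc i"
      using ind inj by (metis vec.dim_span_eq_card_independent card_image card_atLeastAtMost diff_Suc_1)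
    ultimately have "vec.span (b ` {1..Suc i}) = E (Suc i)"
      using Suc.prems dim[of "Suc i"] by (intro vec.subspace_dim_equal sub vec.subspace_span) auto
    with inj ind show ?case by blast
  qed
  have "flag_of b i = E i" for i
    using key[of i] outside unfolding flag_of_def by (auto simp: extensional_def)
  then have "flag_of b = E" by (rule ext)
  then show ?thesis using key[of "CARD('n)"] En unfolding ordered_basis_def by auto
qed

definition flags_of :: "nat \<Rightarrow> 'n::finite basis_tuple \<Rightarrow> (nat \<Rightarrow> 'n flag)" where
  "flags_of d b = (\<lambda>i\<in>{1..d}. flag_of (b i))"

lemma flag_tuple_basis:
  assumes "E \<in> flag_tuples d"
  obtains b where "\<forall>i\<in>{1..d}. ordered_basis (b i)" "flags_of d b = E"
proof -
  have "\<forall>i\<in>{1..d}. \<exists>b. ordered_basis b \<and> flag_of b = E i"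
    using assms complete_flag_basis unfolding flag_tuples_def by blast
  then obtain b where b: "\<forall>i\<in>{1..d}. ordered_basis (b i) \<and> flag_of (b i) = E i" by metis
  then have "flags_of d b = E"
    using assms unfolding flags_of_def flag_tuples_def by (auto simp: PiE_def extensional_def)
  with b that show thesis by blast
qed

text \<open>
  The Zariski open set is the image of the open condition \<open>C\<close>. Two ordered bases have the same
  flag iff they differ by a triangular substitution \<open>b \<mapsto> b \<cdot> g\<close>, so a point of the preimage is
  separated by a polynomial of the form \<open>b \<mapsto> p (b \<cdot> g)\<close>.
\<close>

lemma generically_of_basis_open:
  fixes C :: "'n::finite basis_tuple \<Rightarrow> bool"
  assumes C: "basis_open d C" "C b0"
    and basis: "\<And>b. C b \<Longrightarrow> \<forall>i\<in>{1..d}. ordered_basis (b i)"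
    and Q: "\<And>b. C b \<Longrightarrow> Q (flags_of d b)"
  shows "generically d Q"
proof -
  define U where "U = flags_of d ` Collect C"
  \<comment> \<open>The largest candidate family: all polynomials that vanish at every tuple of
    bases whose flags lie outside \<open>U\<close>.\<close>
  define S where "S = {q \<in> poly_funs d. \<forall>b. (\<forall>i\<in>{1..d}. ordered_basis (b i)) \<longrightarrow>
      q b \<noteq> 0 \<longrightarrow> flags_of d b \<in> U}"
  have "\<exists>q\<in>S. q b \<noteq> 0" if b: "\<forall>i\<in>{1..d}. ordered_basis (b i)" "flags_of d b \<in> U" for b
  proof -
    obtain b' where b': "C b'" "flags_of d b = flags_of d b'" using b(2) unfolding U_def by auto
    obtain p where p: "p \<in> poly_funs d" "p b' \<noteq> 0" "\<And>b. p b \<noteq> 0 \<Longrightarrow> C b"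
      using basis_openE[OF C(1) b'(1)] by blast
    \<comment> \<open>Equal flags have equal initial spans, so \<open>b'\<close> is a triangular
      combination of \<open>b\<close>; the coefficients form \<open>g\<close>.\<close>
    have "\<exists>c. b' i j = (\<Sum>k\<in>{1..j}. c k *s b i k)" if "i \<in> {1..d}" "j \<in> {1..CARD('n)}" for i j
    proof (rule span_image_coeffs)
      have "flag_of (b i) j = flag_of (b' i) j"
        using fun_cong[OF b'(2), of i] that by (simp add: flags_of_def)
      then have "vec.span (b i ` {1..j}) = vec.span (b' i ` {1..j})"
        using that by (simp add: flag_of_def)
      moreover have "b' i j \<in> vec.span (b' i ` {1..j})"
        using that(2) by (intro vec.span_base imageI) simp
      ultimately show "b' i j \<in> vec.span (b i ` {1..j})" by (simp only:)
    qed simp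
    then obtain g where g: "\<And>i j. i \<in> {1..d} \<Longrightarrow> j \<in> {1..CARD('n)} \<Longrightarrow>
        b' i j = (\<Sum>k\<in>{1..j}. g i j k *s b i k)" by metis
    define sub :: "'n basis_tuple \<Rightarrow> 'n basis_tuple"
      where "sub e = (\<lambda>i j. \<Sum>k\<in>{1..j}. g i j k *s e i k)" for e
    define q where "q = (\<lambda>e. p (sub e))"
    have "q \<in> poly_funs d" unfolding q_def
    proof (rule poly_funs_compose[OF p(1)])
      fix i j a assume "i \<in> {1..d}" "j \<in> {1..CARD('n)}"
      then show "(\<lambda>e. vec_nth (sub e i j) a) \<in> poly_funs d"
        unfolding sub_def by (auto intro!: poly_funs_sum poly_funs.mult poly_funs.const poly_funs.coord)
    qed
    moreover have "flags_of d e \<in> U" if e: "\<forall>i\<in>{1..d}. ordered_basis (e i)" "q e \<noteq> 0" for e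
    proof -
      \<comment> \<open>Nonvanishing of \<open>p\<close> at \<open>sub e\<close> also makes
        \<open>sub e\<close> a tuple of bases, as \<open>flag_of_eqI\<close> requires.\<close>
      have Csub: "C (sub e)" using p(3) e(2) unfolding q_def by blast
      have "flag_of (sub e i) = flag_of (e i)" if "i \<in> {1..d}" for i
      proof (rule flag_of_eqI)
        show "ordered_basis (e i)" "ordered_basis (sub e i)" using that e(1) basis[OF Csub] by auto
      qed (auto simp: sub_def intro!: span_image_sum)
      then have "flags_of d e = flags_of d (sub e)" unfolding flags_of_def by auto
      with Csub show ?thesis unfolding U_def by blast
    qed
    moreover have "q b \<noteq> 0"
    proof -
      have "p (sub b) = p b'" by (rule poly_funs_cong[OF p(1)]) (simp add: g sub_def)
      with p(2) show ?thesis unfolding q_def by simp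
    qed
    ultimately show ?thesis unfolding S_def by blast
  qed
  moreover have "U \<subseteq> flag_tuples d"
    unfolding U_def flag_tuples_def flags_of_def using basis flag_of_complete by fastforce
  ultimately have "zariski_open d U"
    unfolding zariski_open_def flags_of_def[symmetric]
    by (intro conjI exI[of _ S]) (auto simp: S_def)
  moreover have "U \<noteq> {}" "\<forall>E\<in>U. Q E" using C(2) Q unfolding U_def by auto
  ultimately show ?thesis unfolding generically_def by blast
qed

text \<open>The passage back from flags to bases: one member of the defining family, chosen nonzero
  over a point of the open set, is enough.\<close>

lemma generically_basis_open:
  fixes Q :: "(nat \<Rightarrow> 'n::finite flag) \<Rightarrow> bool"
  assumes "generically d Q"
  shows "\<exists>p\<in>poly_funs d. (\<exists>b. (\<forall>i\<in>{1..d}. ordered_basis (b i)) \<and> p b \<noteq> 0) \<and>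
    (\<forall>b. (\<forall>i\<in>{1..d}. ordered_basis (b i)) \<longrightarrow> p b \<noteq> 0 \<longrightarrow> Q (flags_of d b))"
proof -
  obtain U where U: "zariski_open d U" "U \<noteq> {}" "\<forall>E\<in>U. Q E"
    using assms unfolding generically_def by auto
  then obtain S where S: "U \<subseteq> flag_tuples d" "S \<subseteq> poly_funs d"
    "\<And>b. \<forall>i\<in>{1..d}. ordered_basis (b i) \<Longrightarrow> flags_of d b \<in> U \<longleftrightarrow> (\<exists>p\<in>S. p b \<noteq> 0)"
    unfolding zariski_open_def flags_of_def[symmetric] by metis
  obtain E where E: "E \<in> U" using U(2) by blast
  with S(1) have "E \<in> flag_tuples d" by blast
  then obtain b0 where "\<forall>i\<in>{1..d}. ordered_basis (b0 i)" "flags_of d b0 = E"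
    by (rule flag_tuple_basis)
  with E have b0: "\<forall>i\<in>{1..d}. ordered_basis (b0 i)" "flags_of d b0 \<in> U" by simp_all
  then obtain p where p: "p \<in> S" "p b0 \<noteq> 0" using S(3)[of b0] by auto
  show ?thesis
  proof (intro bexI[of _ p] conjI exI[of _ b0] allI impI)
    show "Q (flags_of d b)" if "\<forall>i\<in>{1..d}. ordered_basis (b i)" "p b \<noteq> 0" for b
      using S(3)[OF that(1)] that(2) p(1) U(3) by auto
  qed (use p b0 S(2) in auto)
qed

text \<open>Irreducibility of the variety of flag tuples, inherited from the space of tuples of
  vectors, in which being a tuple of bases is itself an open condition.\<close>

lemma generically_conj:
  fixes Q R :: "(nat \<Rightarrow> 'n::finite flag) \<Rightarrow> bool"
  assumes "generically d Q" "generically d R"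
  shows "generically d (\<lambda>E. Q E \<and> R E)"
proof -
  obtain p b1 where p: "p \<in> poly_funs d" "p b1 \<noteq> 0" "\<forall>i\<in>{1..d}. ordered_basis (b1 i)"
    "\<forall>b. (\<forall>i\<in>{1..d}. ordered_basis (b i)) \<longrightarrow> p b \<noteq> 0 \<longrightarrow> Q (flags_of d b)"
    using generically_basis_open[OF assms(1)] by auto
  obtain q b2 where q: "q \<in> poly_funs d" "q b2 \<noteq> 0" "\<forall>i\<in>{1..d}. ordered_basis (b2 i)"
    "\<forall>b. (\<forall>i\<in>{1..d}. ordered_basis (b i)) \<longrightarrow> q b \<noteq> 0 \<longrightarrow> R (flags_of d b)"
    using generically_basis_open[OF assms(2)] by auto
  let ?B = "\<lambda>b :: 'n basis_tuple. \<forall>i\<in>{1..d}. ordered_basis (b i)"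
  have B: "basis_open d ?B" 
    by (rule basis_open_ball) (simp_all add: basis_open_ordered_basis)
  have open': "basis_open d (\<lambda>b. ?B b \<and> p b \<noteq> 0)" "basis_open d (\<lambda>b. q b \<noteq> 0)"
    by (intro basis_open_conj B basis_open_nonzero p(1) q(1))+
  have "\<exists>b. (?B b \<and> p b \<noteq> 0) \<and> q b \<noteq> 0"
    by (rule basis_open_meet[OF open'(1) _ open'(2), of b1 b2]) (use p(2,3) q(2) in blast)+
  then obtain b where "(?B b \<and> p b \<noteq> 0) \<and> q b \<noteq> 0" ..
  then show ?thesis
    by (rule generically_of_basis_open[OF basis_open_conj[OF open']]) (use p(4) q(4) in auto)
qed

lemma generically_mono:
  assumes "generically d Q" "\<And>E. E \<in> flag_tuples d \<Longrightarrow> Q E \<Longrightarrow> R E"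
  shows "generically d R"
proof -
  obtain U where "zariski_open d U" "U \<noteq> {}" "\<forall>E\<in>U. Q E"
    using assms(1) unfolding generically_def by auto
  moreover have "U \<subseteq> flag_tuples d" using \<open>zariski_open d U\<close> unfolding zariski_open_def by simp
  ultimately show ?thesis using assms(2) unfolding generically_def by (intro exI[of _ U]) auto
qed

lemma generically_ex:
  assumes "generically d Q"
  shows "\<exists>E. Q E"
  using assms unfolding generically_def by auto

section \<open>Independent sets of the matroid and generic flags\<close>

lemma T_points_coord_less:
  assumes "y \<in> T_points n d" "i \<in> {1..d}" "0 < n"
  shows "y i < n"
proof -
  have "y i \<le> (\<Sum>i\<in>{1..d}. y i)" using assms(2) by (intro member_le_sum) auto
  also have "\<dots> = n - 1" using assms(1) unfolding T_points_def by simp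
  finally show ?thesis using assms(3) by simp
qed

lemma finite_T_points: "finite (T_points n d)"
proof (rule finite_subset)
  show "T_points n d \<subseteq> {1..d} \<rightarrow>\<^sub>E {..n - 1}"
  proof
    fix y assume y: "y \<in> T_points n d"
    have "y i \<le> n - 1" if "i \<in> {1..d}" for i
    proof -
      have "y i \<le> (\<Sum>i\<in>{1..d}. y i)" using that by (intro member_le_sum) auto
      also have "\<dots> = n - 1" using y unfolding T_points_def by simp
      finally show ?thesis .
    qed
    with y show "y \<in> {1..d} \<rightarrow>\<^sub>E {..n - 1}" unfolding T_points_def PiE_def Pi_def by simp
  qed
qed (intro finite_PiE; simp)

lemma finite_T_indep: "T_indep n d I \<Longrightarrow> finite I"
  unfolding T_indep_def using finite_subset[OF _ finite_T_points] by blast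

lemma T_indep_card_above:
  assumes I: "T_indep n d I" and a: "(\<Sum>i\<in>{1..d}. a i) < n"
  shows "card {z \<in> I. \<forall>i\<in>{1..d}. a i \<le> z i} \<le> n - (\<Sum>i\<in>{1..d}. a i)"
proof -
  let ?k = "n - (\<Sum>i\<in>{1..d}. a i)"
  have "?k \<in> {1..n}" "(\<Sum>i\<in>{1..d}. a i) = n - ?k" using a by auto
  then have "card (I \<inter> {y \<in> T_points n d. \<forall>i\<in>{1..d}. a i \<le> y i}) \<le> ?k"
    using I unfolding T_indep_def by blast
  moreover have "I \<inter> {y \<in> T_points n d. \<forall>i\<in>{1..d}. a i \<le> y i} = {z \<in> I. \<forall>i\<in>{1..d}. a i \<le> z i}"
    using I unfolding T_indep_def by blast
  ultimately show ?thesis by simp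
qed

lemma T_indep_card_le:
  assumes "T_indep n d I" "0 < n"
  shows "card I \<le> n"
  using T_indep_card_above[of n d I "\<lambda>_. 0"] assms by simp

text \<open>The support permitted for the functional \<open>h i j\<close>: if
  \<open>j \<le> z i\<close>, it is among those cutting out \<open>E i (n - z i)\<close> and has to
  vanish on the basis vector \<open>e z\<close>.\<close>

definition allowed :: "((nat \<Rightarrow> nat) \<Rightarrow> 'n) \<Rightarrow> dots \<Rightarrow> nat \<Rightarrow> nat \<Rightarrow> 'n set" where
  "allowed e I i j = - e ` {z \<in> I. j \<le> z i}"

text \<open>A subfamily of the sets \<open>allowed e I i j\<close> may be enlarged to \<open>{(i, j). j \<le> a i}\<close> without
  changing its union, the complement of \<open>{z \<in> I. a \<le> z}\<close>; so Hall's condition is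
  the bound in the definition of \<open>T_indep\<close>.\<close>

lemma allowed_matching:
  fixes e :: "(nat \<Rightarrow> nat) \<Rightarrow> 'n::finite"
  assumes I: "T_indep CARD('n) d I" and e: "inj_on e I"
    and u: "(\<Sum>i\<in>{1..d}. u i) < CARD('n)"
  shows "\<exists>m. inj_on m (SIGMA i:{1..d}. {1..u i}) \<and>
    (\<forall>i\<in>{1..d}. \<forall>j\<in>{1..u i}. m (i, j) \<in> allowed e I i j)"
proof -
  have "\<exists>m. inj_on m (SIGMA i:{1..d}. {1..u i}) \<and>
    (\<forall>s\<in>(SIGMA i:{1..d}. {1..u i}). m s \<in> (case s of (i, j) \<Rightarrow> allowed e I i j))"
  proof (rule hall)
    fix K assume K: "K \<subseteq> (SIGMA i:{1..d}. {1..u i})"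
    have finK: "finite K" using K by (rule finite_subset) auto
    \<comment> \<open>The topmost index of \<open>K\<close> in row \<open>i\<close>; the inserted 0
      is the value for rows that \<open>K\<close> misses.\<close>
    define a where "a i = Max (insert 0 (Pair i -` K))" for i
    have fin: "finite (Pair i -` K)" for i using finK by (intro finite_vimageI) (auto simp: inj_on_def)
    have a_ge: "j \<le> a i" if "(i, j) \<in> K" for i j
      unfolding a_def using fin that by (intro Max_ge) auto
    have a_le: "a i \<le> c" if "\<And>j. (i, j) \<in> K \<Longrightarrow> j \<le> c" for i c
      unfolding a_def using fin that by (subst Max_le_iff) auto
    have "(\<Sum>i\<in>{1..d}. a i) \<le> (\<Sum>i\<in>{1..d}. u i)"
      using K by (intro sum_mono a_le) auto
    with u have sum_a: "(\<Sum>i\<in>{1..d}. a i) < CARD('n)" by simp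
    have "card K \<le> card (SIGMA i:{1..d}. {1..a i})"
      using K a_ge by (intro card_mono) auto
    then have card_K: "card K \<le> (\<Sum>i\<in>{1..d}. a i)" by (simp add: card_SigmaI)
    show "card K \<le> card (\<Union>s\<in>K. case s of (i, j) \<Rightarrow> allowed e I i j)"
    proof (cases "K = {}")
      case False
      \<comment> \<open>One pair of \<open>K\<close> serves to write a missed \<open>x\<close> as
        \<open>e z\<close>; injectivity of \<open>e\<close> makes the same \<open>z\<close> work for
        all pairs.\<close>
      then obtain i0 j0 where ij0: "(i0, j0) \<in> K" by auto
      let ?Z = "{z \<in> I. \<forall>i\<in>{1..d}. a i \<le> z i}"
      have "card K \<le> CARD('n) - card ?Z"
        using T_indep_card_above[OF I sum_a] card_K sum_a by linarith
      also have "\<dots> = card (- e ` ?Z)"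
        using inj_on_subset[OF e, of ?Z] by (simp add: Compl_eq_Diff_UNIV card_Diff_subset card_image)
      also have "- e ` ?Z \<subseteq> (\<Union>s\<in>K. case s of (i, j) \<Rightarrow> allowed e I i j)"
      proof
        fix x assume x: "x \<in> - e ` ?Z"
        show "x \<in> (\<Union>s\<in>K. case s of (i, j) \<Rightarrow> allowed e I i j)"
        proof (rule ccontr)
          assume "\<not> ?thesis"
          then have *: "x \<in> e ` {z \<in> I. j \<le> z i}" if "(i, j) \<in> K" for i j
            using that unfolding allowed_def by force
          from *[OF ij0] obtain z where z: "z \<in> I" "x = e z" by blast
          have "j \<le> z i" if "(i, j) \<in> K" for i j
            using *[OF that] z inj_onD[OF e] by auto
          then have "z \<in> ?Z" using z(1) a_le by auto
          with x z(2) show False by blast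
        qed
      qed
      then have "card (- e ` ?Z) \<le> card (\<Union>s\<in>K. case s of (i, j) \<Rightarrow> allowed e I i j)"
        by (intro card_mono) auto
      finally show ?thesis .
    qed simp
  qed auto
  then show ?thesis by (auto simp: Ball_def)
qed

text \<open>\<open>allowed_matching\<close> reaches only \<open>CARD('n) - 1\<close> functionals of
  one flag. The last one has full support, because coordinates of points are below
  \<open>CARD('n)\<close>, and takes a coordinate left over.\<close>

lemma allowed_matching_full:
  fixes e :: "(nat \<Rightarrow> nat) \<Rightarrow> 'n::finite"
  assumes I: "T_indep CARD('n) d I" and e: "inj_on e I" and i: "i \<in> {1..d}"
  shows "\<exists>m. inj_on m {1..CARD('n)} \<and> (\<forall>j\<in>{1..CARD('n)}. m j \<in> allowed e I i j)"
proof -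
  define u where "u i' = (if i' = i then CARD('n) - 1 else 0)" for i'
  have "(\<Sum>i\<in>{1..d}. u i) < CARD('n)" using i unfolding u_def by simp
  from allowed_matching[OF I e this] obtain m where
    m: "inj_on m (SIGMA i:{1..d}. {1..u i})" "\<And>j. j \<in> {1..u i} \<Longrightarrow> m (i, j) \<in> allowed e I i j"
    using i by blast
  have u: "u i = CARD('n) - 1" unfolding u_def by simp
  have "card ((\<lambda>j. m (i, j)) ` {1..u i}) \<le> u i"
    using card_image_le[of "{1..u i}" "\<lambda>j. m (i, j)"] by simp
  also have "\<dots> < CARD('n)" unfolding u by simp
  finally obtain x where x: "x \<notin> (\<lambda>j. m (i, j)) ` {1..u i}"
    by (metis UNIV_eq_I less_irrefl)
  have "allowed e I i CARD('n) = UNIV"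
    using I T_points_coord_less[OF _ i] unfolding allowed_def T_indep_def by fastforce
  moreover have "j \<in> {1..u i}" if "j \<in> {1..CARD('n)}" "j \<noteq> CARD('n)" for j
    using that unfolding u by auto
  moreover have "inj_on (\<lambda>j. if j = CARD('n) then x else m (i, j)) {1..CARD('n)}"
  proof (rule inj_onI)
    fix j k assume jk: "j \<in> {1..CARD('n)}" "k \<in> {1..CARD('n)}"
      "(if j = CARD('n) then x else m (i, j)) = (if k = CARD('n) then x else m (i, k))"
    show "j = k"
      using jk x i calculation(2) inj_onD[OF m(1), of "(i, j)" "(i, k)"]
      by (auto split: if_splits)
  qed
  ultimately show ?thesis using m(2)
    by (intro exI[of _ "\<lambda>j. if j = CARD('n) then x else m (i, j)"]) auto
qed

section \<open>Functionals, dual bases and lines in coordinate position\<close>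

text \<open>No conjugation, so that the pairing is complex bilinear and polynomial in both
  arguments.\<close>

definition bilinear_dot :: "complex ^ 'n::finite \<Rightarrow> complex ^ 'n \<Rightarrow> complex" where
  "bilinear_dot h v = (\<Sum>a\<in>UNIV. vec_nth h a * vec_nth v a)"

lemma bilinear_dot_sum:
  "bilinear_dot h (\<Sum>k\<in>K. c k *s b k) = (\<Sum>k\<in>K. c k * bilinear_dot h (b k))"
proof -
  have "bilinear_dot h (\<Sum>k\<in>K. c k *s b k) =
      (\<Sum>a\<in>UNIV. \<Sum>k\<in>K. vec_nth h a * (c k * vec_nth (b k) a))"
    unfolding bilinear_dot_def by (simp add: sum_distrib_left)
  also have "\<dots> = (\<Sum>k\<in>K. \<Sum>a\<in>UNIV. vec_nth h a * (c k * vec_nth (b k) a))"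
    by (rule sum.swap)
  finally show ?thesis
    unfolding bilinear_dot_def by (simp add: sum_distrib_left mult.left_commute)
qed

text \<open>Functionals with trivial common kernel form an invertible matrix, and \<open>b\<close>
  lists the columns of its inverse in reversed order. The reversal makes the first \<open>m\<close>
  functionals vanish on the first \<open>CARD('n) - m\<close> vectors, so they cut out that step of
  the flag.\<close>

lemma dual_basis:
  fixes h :: "nat \<Rightarrow> complex ^ 'n::finite"
  assumes inj: "\<And>v. \<forall>j\<in>{1..CARD('n)}. bilinear_dot (h j) v = 0 \<Longrightarrow> v = 0"
  shows "\<exists>b. ordered_basis b \<and> (\<forall>j\<in>{1..CARD('n)}. \<forall>k\<in>{1..CARD('n)}.
    bilinear_dot (h j) (b k) = (if j + k = CARD('n) + 1 then 1 else 0))"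
proof -
  \<comment> \<open>Matrix rows are indexed by the type \<open>'n\<close>, functionals by numbers;
    \<open>f\<close> translates.\<close>
  obtain f :: "'n \<Rightarrow> nat" where f: "bij_betw f UNIV {1..CARD('n)}"
    using finite_same_card_bij[of "UNIV :: 'n set" "{1..CARD('n)}"] by auto
  have f_surj: "\<exists>r. j = f r" if "j \<in> {1..CARD('n)}" for j
    using f that unfolding bij_betw_def by (metis imageE)
  define H :: "complex ^ 'n ^ 'n" where "H = (\<chi> r. h (f r))"
  have H: "vec_nth (H *v v) r = bilinear_dot (h (f r)) v" for v r
    unfolding H_def matrix_vector_mult_def bilinear_dot_def by simp
  have "\<forall>v. H *v v = 0 \<longrightarrow> v = 0"
  proof (intro allI impI inj ballI)
    fix v j assume v: "H *v v = 0" and j: "j \<in> {1..CARD('n)}"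
    obtain r where "j = f r" using f_surj[OF j] ..
    with v H[of v r] show "bilinear_dot (h j) v = 0" by simp
  qed
  then obtain B where "B ** H = Finite_Cartesian_Product.mat 1"
    using matrix_left_invertible_ker by blast
  then have "H ** B = Finite_Cartesian_Product.mat 1" by (simp add: matrix_left_right_inverse)
  then have "surj ((*v) H)" using matrix_right_invertible_surjective by blast
  then have "\<exists>v. H *v v = (\<chi> r. if f r + k = CARD('n) + 1 then 1 else 0)" for k
    by (metis surjD)
  then obtain b where b: "\<And>k. H *v b k = (\<chi> r. if f r + k = CARD('n) + 1 then 1 else 0)" by metis
  have dot: "bilinear_dot (h j) (b k) = (if j + k = CARD('n) + 1 then 1 else 0)"
    if j: "j \<in> {1..CARD('n)}" for j k
  proof -
    obtain r where "j = f r" using f_surj[OF j] ..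
    then show ?thesis using H[of "b k" r] by (simp add: b)
  qed
  have "ordered_basis b" unfolding ordered_basis_iff
  proof (intro allI impI ballI)
    fix c k assume c: "(\<Sum>k\<in>{1..CARD('n)}. c k *s b k) = 0" and k: "k \<in> {1..CARD('n)}"
    \<comment> \<open>Pairing the relation with this \<open>h j\<close> isolates the coefficient
      \<open>c k\<close>.\<close>
    define j where "j = CARD('n) + 1 - k"
    have j: "j \<in> {1..CARD('n)}" using k unfolding j_def by auto
    have iff: "j + l = CARD('n) + 1 \<longleftrightarrow> l = k" for l using k unfolding j_def by auto
    have "0 = (\<Sum>l\<in>{1..CARD('n)}. c l * bilinear_dot (h j) (b l))"
      unfolding bilinear_dot_sum[symmetric] c by (simp add: bilinear_dot_def)
    also have "\<dots> = (\<Sum>l\<in>{1..CARD('n)}. if l = k then c l else 0)"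
      by (intro sum.cong refl, subst dot[OF j], subst iff) simp
    also have "\<dots> = c k" using k by simp
    finally show "c k = 0" by simp
  qed
  with dot show ?thesis by blast
qed

text \<open>A vector in all the spans for \<open>y\<close> is killed by the functionals
  \<open>(i, j)\<close> with \<open>j \<le> y i\<close>. There are \<open>CARD('n) - 1\<close> of
  them, none involves the coordinate \<open>e y\<close>, and generically they are independent on the
  other coordinates.\<close>

lemma lines_in_coordinate_position:
  fixes e :: "(nat \<Rightarrow> nat) \<Rightarrow> 'n::finite"
  assumes I: "T_indep CARD('n) d I" and e: "inj_on e I"
  shows "\<exists>b :: 'n basis_tuple. (\<forall>i\<in>{1..d}. ordered_basis (b i)) \<and>
    (\<forall>y\<in>I. \<forall>v. (\<forall>i\<in>{1..d}. v \<in> vec.span (b i ` {1..CARD('n) - y i})) \<longrightarrow>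
       (\<forall>a. a \<noteq> e y \<longrightarrow> vec_nth v a = 0))"
proof -
  have T: "y \<in> T_points CARD('n) d" if "y \<in> I" for y using that I unfolding T_indep_def by blast
  have y_less: "y i < CARD('n)" if "y \<in> I" "i \<in> {1..d}" for y i
    using T_points_coord_less[OF T] that by simp
  \<comment> \<open>Masking imposes the supports while \<open>h\<close> still ranges over all tuples
    of vectors, where irreducibility is available.\<close>
  define mask :: "'n basis_tuple \<Rightarrow> 'n basis_tuple"
    where "mask h = (\<lambda>i j. \<chi> a. if a \<in> allowed e I i j then vec_nth (h i j) a else 0)" for h
  have mask_poly: "(\<lambda>h. vec_nth (mask h i j) a) \<in> poly_funs d"
    if "i \<in> {1..d}" "j \<in> {1..CARD('n)}" for i j a
    using that unfolding mask_def
    by (cases "a \<in> allowed e I i j") (simp_all add: poly_funs.coord poly_funs.const)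
  \<comment> \<open>\<open>C1 i\<close> gives the functionals of flag \<open>i\<close> a dual basis;
    \<open>C2 y\<close> says that those cutting out the line of \<open>y\<close> form an invertible
    matrix off the coordinate \<open>e y\<close>.\<close>
  define C1 where "C1 i h \<longleftrightarrow> (\<forall>c. (\<forall>j\<in>{1..CARD('n)}. (\<Sum>a\<in>UNIV. vec_nth (mask h i j) a * c a) = 0)
      \<longrightarrow> (\<forall>a\<in>UNIV. c a = 0))" for i h
  define C2 where "C2 y h \<longleftrightarrow> (\<forall>c. (\<forall>r\<in>(SIGMA i:{1..d}. {1..y i}).
        (\<Sum>a\<in>UNIV - {e y}. vec_nth (mask h (fst r) (snd r)) a * c a) = 0)
      \<longrightarrow> (\<forall>a\<in>UNIV - {e y}. c a = 0))" for y h
  have open1: "basis_open d (C1 i)" if "i \<in> {1..d}" for i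
    unfolding C1_def using that by (intro basis_open_injective mask_poly) auto
  have open2: "basis_open d (C2 y)" if "y \<in> I" for y
    unfolding C2_def
  proof (intro basis_open_injective mask_poly)
    fix r assume "r \<in> (SIGMA i:{1..d}. {1..y i})"
    then show "fst r \<in> {1..d}" "snd r \<in> {1..CARD('n)}"
      using y_less[OF that, of "fst r"] by auto
  qed simp
  \<comment> \<open>Unit vectors at allowed coordinates survive masking, so a matching yields a
    permutation matrix.\<close>
  have mask_axis: "vec_nth (mask (\<lambda>i j. axis (m i j) 1) i j) a = (if a = m i j then 1 else 0)"
    if "m i j \<in> allowed e I i j" for m i j a
    using that unfolding mask_def axis_def by simp
  have ex1: "\<exists>h. C1 i h" if i: "i \<in> {1..d}" for i
  proof -
    obtain m where m: "inj_on m {1..CARD('n)}" "\<And>j. j \<in> {1..CARD('n)} \<Longrightarrow> m j \<in> allowed e I i j"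
      using allowed_matching_full[OF I e i] by blast
    have "card (m ` {1..CARD('n)}) = CARD('n)" using card_image[OF m(1)] by simp
    then have surj: "m ` {1..CARD('n)} = UNIV" by (intro card_subset_eq) auto
    have "C1 i (\<lambda>i j. axis (m j) 1)" unfolding C1_def
    proof (intro allI impI ballI)
      fix c a assume c: "\<forall>j\<in>{1..CARD('n)}. (\<Sum>a\<in>UNIV. vec_nth (mask (\<lambda>i j. axis (m j) 1) i j) a * c a) = 0"
      obtain j where j: "j \<in> {1..CARD('n)}" "a = m j" using surj by blast
      have "(\<Sum>a\<in>UNIV. vec_nth (mask (\<lambda>i j. axis (m j) 1) i j) a * c a) =
          (\<Sum>a\<in>UNIV. if a = m j then c a else 0)"
        using mask_axis[of "\<lambda>i. m" i j] m(2)[OF j(1)] by (intro sum.cong) auto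
      with c j show "c a = 0" by auto
    qed
    then show ?thesis by blast
  qed
  have ex2: "\<exists>h. C2 y h" if y: "y \<in> I" for y
  proof -
    let ?J = "SIGMA i:{1..d}. {1..y i}"
    have sum_y: "(\<Sum>i\<in>{1..d}. y i) = CARD('n) - 1" using T[OF y] unfolding T_points_def by simp
    then have "(\<Sum>i\<in>{1..d}. y i) < CARD('n)" by simp
    from allowed_matching[OF I e this] obtain m where
      m: "inj_on m ?J" "\<forall>i\<in>{1..d}. \<forall>j\<in>{1..y i}. m (i, j) \<in> allowed e I i j" by blast
    \<comment> \<open>\<open>j \<le> y i\<close> forbids the value \<open>e y\<close>; as the
      coordinates of \<open>y\<close> sum to \<open>CARD('n) - 1\<close>, the matching takes every
      other value.\<close>
    have sub: "m ` ?J \<subseteq> UNIV - {e y}" using m(2) y unfolding allowed_def by fastforce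
    have "card (m ` ?J) = card (UNIV - {e y})"
      using sum_y by (simp add: card_image[OF m(1)] card_SigmaI card_Diff_singleton
          del: One_nat_def)
    with sub have surj: "m ` ?J = UNIV - {e y}" by (intro card_subset_eq) auto
    define h :: "'n basis_tuple" where "h = (\<lambda>i j. axis (m (i, j)) 1)"
    have "C2 y h" unfolding C2_def
    proof (intro allI impI ballI)
      fix c a assume c: "\<forall>r\<in>?J. (\<Sum>a\<in>UNIV - {e y}. vec_nth (mask h (fst r) (snd r)) a * c a) = 0"
        and a: "a \<in> UNIV - {e y}"
      obtain i j where ij: "(i, j) \<in> ?J" "a = m (i, j)" using surj a by (metis imageE surj_pair)
      have "(\<Sum>a\<in>UNIV - {e y}. vec_nth (mask h i j) a * c a) =
          (\<Sum>a\<in>UNIV - {e y}. if a = m (i, j) then c a else 0)"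
        using mask_axis[of "\<lambda>i j. m (i, j)" i j] m(2) ij(1) unfolding h_def by (intro sum.cong) auto
      also have "\<dots> = c a" using a ij(2) by simp
      finally show "c a = 0" using c ij(1) by force
    qed
    then show ?thesis by blast
  qed
  have finI: "finite I" using finite_T_indep[OF I] .
  have "\<exists>h. \<forall>i\<in>{1..d}. C1 i h"
    by (rule basis_open_meet_finite[OF _ open1 ex1]) simp_all
  then obtain h1 where h1: "\<forall>i\<in>{1..d}. C1 i h1" ..
  have "\<exists>h. \<forall>y\<in>I. C2 y h"
    by (rule basis_open_meet_finite[OF finI open2 ex2])
  then obtain h2 where h2: "\<forall>y\<in>I. C2 y h2" ..
  have "basis_open d (\<lambda>h. \<forall>i\<in>{1..d}. C1 i h)" "basis_open d (\<lambda>h. \<forall>y\<in>I. C2 y h)"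
    by (rule basis_open_ball; simp add: open1 open2 finI)+
  from basis_open_meet[OF this(1) _ this(2), of h1 h2] h1 h2 obtain h where h: "\<forall>i\<in>{1..d}. C1 i h" "\<forall>y\<in>I. C2 y h" by blast
  have "\<exists>b. ordered_basis b \<and> (\<forall>j\<in>{1..CARD('n)}. \<forall>k\<in>{1..CARD('n)}.
    bilinear_dot (mask h i j) (b k) = (if j + k = CARD('n) + 1 then 1 else 0))" if "i \<in> {1..d}" for i
  proof (rule dual_basis)
    fix v assume "\<forall>j\<in>{1..CARD('n)}. bilinear_dot (mask h i j) v = 0"
    then have "\<forall>a\<in>UNIV. vec_nth v a = 0"
      using h(1) that unfolding C1_def bilinear_dot_def by blast
    then show "v = 0" by (simp add: Finite_Cartesian_Product.vec_eq_iff)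
  qed
  then obtain b where b: "\<And>i. i \<in> {1..d} \<Longrightarrow> ordered_basis (b i)"
    "\<And>i j k. i \<in> {1..d} \<Longrightarrow> j \<in> {1..CARD('n)} \<Longrightarrow> k \<in> {1..CARD('n)} \<Longrightarrow>
      bilinear_dot (mask h i j) (b i k) = (if j + k = CARD('n) + 1 then 1 else 0)"
    by metis
  have "vec_nth v a = 0" if y: "y \<in> I" and a: "a \<noteq> e y"
    and v: "\<And>i. i \<in> {1..d} \<Longrightarrow> v \<in> vec.span (b i ` {1..CARD('n) - y i})" for y v a
  proof -
    have "(\<Sum>a\<in>UNIV - {e y}. vec_nth (mask h i j) a * vec_nth v a) = 0"
      if i: "i \<in> {1..d}" and j: "j \<in> {1..y i}" for i j
    proof -
      have j': "j \<in> {1..CARD('n)}" using j y_less[OF y i] by auto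
      obtain c where c: "v = (\<Sum>k\<in>{1..CARD('n) - y i}. c k *s b i k)"
        using span_image_coeffs[OF _ v[OF i]] by auto
      have "bilinear_dot (mask h i j) v = (\<Sum>k\<in>{1..CARD('n) - y i}. c k * bilinear_dot (mask h i j) (b i k))"
        unfolding c bilinear_dot_sum ..
      \<comment> \<open>\<open>k \<le> CARD('n) - y i\<close> and \<open>j \<le> y i\<close> give
        \<open>j + k \<le> CARD('n)\<close>, so every pairing is 0.\<close>
      also have "\<dots> = 0" using j by (intro sum.neutral ballI) (subst b(2)[OF i j'], auto)
      finally have "(\<Sum>a\<in>UNIV. vec_nth (mask h i j) a * vec_nth v a) = 0"
        unfolding bilinear_dot_def .
      moreover have "vec_nth (mask h i j) (e y) = 0"
        using y j unfolding mask_def allowed_def by auto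
      ultimately show ?thesis by (subst (asm) sum.remove[of _ "e y"]) auto
    qed
    then have "\<forall>r\<in>(SIGMA i:{1..d}. {1..y i}).
        (\<Sum>a\<in>UNIV - {e y}. vec_nth (mask h (fst r) (snd r)) a * vec_nth v a) = 0" by auto
    moreover have "C2 y h" using h(2) y by blast
    ultimately have "\<forall>a\<in>UNIV - {e y}. vec_nth v a = 0"
      unfolding C2_def using spec[of _ "vec_nth v"] by blast
    with a show ?thesis by blast
  qed
  with b(1) show ?thesis by (intro exI[of _ b]) blast
qed

text \<open>Directness of the sum of the spaces \<open>\<Inter>i. E i (n - y i)\<close> is an open
  condition, and it holds for a tuple of flags that puts these spaces inside distinct coordinate
  axes.\<close>

lemma generically_T_independent:
  assumes I: "T_indep CARD('n) d I"
  shows "generically d (\<lambda>E :: nat \<Rightarrow> 'n::finite flag.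
    \<forall>v. (\<forall>y\<in>I. \<forall>i\<in>{1..d}. v y \<in> E i (CARD('n) - y i)) \<longrightarrow> (\<Sum>y\<in>I. v y) = 0 \<longrightarrow>
      (\<forall>y\<in>I. v y = 0))"
proof -
  let ?N = "CARD('n)"
  have finI: "finite I" using finite_T_indep[OF I] .
  have "card I \<le> card (UNIV :: 'n set)" using T_indep_card_le[OF I] by simp
  then obtain e :: "(nat \<Rightarrow> nat) \<Rightarrow> 'n" where e: "inj_on e I"
    using card_le_inj[OF finI finite] by blast
  obtain b0 :: "'n basis_tuple" where b0: "\<forall>i\<in>{1..d}. ordered_basis (b0 i)"
    and lines: "\<And>y v a. y \<in> I \<Longrightarrow> \<forall>i\<in>{1..d}. v \<in> vec.span (b0 i ` {1..?N - y i}) \<Longrightarrow> a \<noteq> e y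
      \<Longrightarrow> vec_nth v a = 0"
    using lines_in_coordinate_position[OF I e] by blast
  \<comment> \<open>The condition as injectivity of a matrix \<open>M\<close> that is polynomial in the bases: the unknowns
    \<open>Inl (y, a)\<close> are the coordinates of \<open>v y\<close>, the unknowns \<open>Inr (y, i, j)\<close> the coefficients of
    \<open>v y\<close> at \<open>b i j\<close>; the rows \<open>Inl (y, i, a)\<close> link the two, the rows \<open>Inr a\<close> say that the
    \<open>v y\<close> sum to 0.\<close>
  define S :: "((nat \<Rightarrow> nat) \<times> 'n + (nat \<Rightarrow> nat) \<times> nat \<times> nat) set"
    where "S = (I \<times> UNIV) <+> (SIGMA y:I. SIGMA i:{1..d}. {1..?N - y i})"
  define R :: "((nat \<Rightarrow> nat) \<times> nat \<times> 'n + 'n) set" where "R = (I \<times> {1..d} \<times> UNIV) <+> UNIV"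
  define M :: "(nat \<Rightarrow> nat) \<times> nat \<times> 'n + 'n \<Rightarrow> (nat \<Rightarrow> nat) \<times> 'n + (nat \<Rightarrow> nat) \<times> nat \<times> nat
      \<Rightarrow> 'n basis_tuple \<Rightarrow> complex" where
    "M r s = (case r of
       Inl (y, i, a) \<Rightarrow> (case s of
           Inl (y', a') \<Rightarrow> \<lambda>b. if y' = y \<and> a' = a then - 1 else 0
         | Inr (y', i', j) \<Rightarrow> if y' = y \<and> i' = i then \<lambda>b. vec_nth (b i j) a else (\<lambda>b. 0))
     | Inr a \<Rightarrow> (case s of Inl (y', a') \<Rightarrow> \<lambda>b. if a' = a then 1 else 0 | Inr _ \<Rightarrow> \<lambda>b. 0))" for r s
  have finS: "finite S" unfolding S_def using finI by auto
  have row1: "(\<Sum>s\<in>S. M (Inl (y, i, a)) s b * c s) =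
      (\<Sum>j\<in>{1..?N - y i}. c (Inr (y, i, j)) * vec_nth (b i j) a) - c (Inl (y, a))"
    if y: "y \<in> I" and i: "i \<in> {1..d}" for y i a b c
  proof -
    let ?B = "(\<lambda>j. Inr (y, i, j)) ` {1..?N - y i}"
    have "(\<Sum>s\<in>S. M (Inl (y, i, a)) s b * c s) =
        (\<Sum>s\<in>insert (Inl (y, a)) ?B. M (Inl (y, i, a)) s b * c s)"
      using y i by (intro sum.mono_neutral_right finS) (auto simp: S_def M_def)
    also have "\<dots> = M (Inl (y, i, a)) (Inl (y, a)) b * c (Inl (y, a)) +
        (\<Sum>s\<in>?B. M (Inl (y, i, a)) s b * c s)" by (rule sum.insert) auto
    also have "(\<Sum>s\<in>?B. M (Inl (y, i, a)) s b * c s) =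
        (\<Sum>j\<in>{1..?N - y i}. vec_nth (b i j) a * c (Inr (y, i, j)))"
      by (subst sum.reindex) (auto simp: inj_on_def M_def)
    finally show ?thesis by (simp add: M_def mult.commute)
  qed
  have row2: "(\<Sum>s\<in>S. M (Inr a) s b * c s) = (\<Sum>y\<in>I. c (Inl (y, a)))" for a b c
  proof -
    have "(\<Sum>s\<in>S. M (Inr a) s b * c s) = (\<Sum>s\<in>(\<lambda>y. Inl (y, a)) ` I. M (Inr a) s b * c s)"
      by (intro sum.mono_neutral_right finS) (auto simp: S_def M_def)
    also have "\<dots> = (\<Sum>y\<in>I. c (Inl (y, a)))"
      by (subst sum.reindex) (auto simp: inj_on_def M_def)
    finally show ?thesis .
  qed
  \<comment> \<open>At tuples of bases the unknowns \<open>Inr\<close> are determined by the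
    \<open>v y\<close>, so injectivity of \<open>M\<close> amounts to the independence
    claimed.\<close>
  define C where "C b \<longleftrightarrow> (\<forall>c. (\<forall>r\<in>R. (\<Sum>s\<in>S. M r s b * c s) = 0) \<longrightarrow> (\<forall>s\<in>S. c s = 0))" for b
  have "M r s \<in> poly_funs d" if "r \<in> R" "s \<in> S" for r s
    using that unfolding R_def S_def M_def
    by (auto split: if_splits simp: poly_funs.const intro!: poly_funs.coord)
  then have "basis_open d C" unfolding C_def using finS by (intro basis_open_injective)
  then have op: "basis_open d (\<lambda>b. (\<forall>i\<in>{1..d}. ordered_basis (b i)) \<and> C b)"
    by (intro basis_open_conj basis_open_ball basis_open_ordered_basis) auto
  have "C b0" unfolding C_def
  proof (intro allI impI)
    fix c assume c: "\<forall>r\<in>R. (\<Sum>s\<in>S. M r s b0 * c s) = 0"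
    define v :: "(nat \<Rightarrow> nat) \<Rightarrow> complex ^ 'n" where "v y = (\<chi> a. c (Inl (y, a)))" for y
    have v: "v y = (\<Sum>j\<in>{1..?N - y i}. c (Inr (y, i, j)) *s b0 i j)"
      if "y \<in> I" "i \<in> {1..d}" for y i
    proof -
      have "Inl (y, i, a) \<in> R" for a using that unfolding R_def by auto
      then have "(\<Sum>j\<in>{1..?N - y i}. c (Inr (y, i, j)) * vec_nth (b0 i j) a) - c (Inl (y, a)) = 0" for a
        using c row1[OF that, of a b0 c] by simp
      then show ?thesis by (simp add: v_def Finite_Cartesian_Product.vec_eq_iff)
    qed
    have v_span: "\<forall>i\<in>{1..d}. v y \<in> vec.span (b0 i ` {1..?N - y i})" if "y \<in> I" for y
    proof
      show "v y \<in> vec.span (b0 i ` {1..?N - y i})" if "i \<in> {1..d}" for i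
        unfolding v[OF \<open>y \<in> I\<close> that] by (rule span_image_sum)
    qed
    have v0: "v y = 0" if y: "y \<in> I" for y
    proof -
      \<comment> \<open>All other \<open>v z\<close> vanish at the coordinate \<open>e y\<close>, so
        the zero sum leaves only the term of \<open>y\<close>.\<close>
      have "vec_nth (v y) (e y) = 0"
      proof -
        have "Inr (e y) \<in> R" unfolding R_def by auto
        then have "0 = (\<Sum>z\<in>I. vec_nth (v z) (e y))" using c row2[of "e y" b0 c] by (simp add: v_def)
        also have "\<dots> = (\<Sum>z\<in>I. if z = y then vec_nth (v y) (e y) else 0)"
        proof (intro sum.cong refl)
          fix z assume z: "z \<in> I"
          show "vec_nth (v z) (e y) = (if z = y then vec_nth (v y) (e y) else 0)"
            using lines[OF z v_span[OF z], of "e y"] inj_onD[OF e _ y z] by auto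
        qed
        also have "\<dots> = vec_nth (v y) (e y)" using y finI by simp
        finally show ?thesis by simp
      qed
      then have "vec_nth (v y) a = 0" for a
        using lines[OF y v_span[OF y], of a] by (cases "a = e y") auto
      then show ?thesis by (simp add: Finite_Cartesian_Product.vec_eq_iff)
    qed
    have "c (Inl (y, a)) = 0" if "y \<in> I" for y a
      using v0[OF that] by (simp add: v_def Finite_Cartesian_Product.vec_eq_iff)
    moreover have "c (Inr (y, i, j)) = 0" if "y \<in> I" "i \<in> {1..d}" "j \<in> {1..?N - y i}" for y i j
    proof -
      \<comment> \<open>Padding with zeros brings the relation to the full index range of
        \<open>ordered_basis_iff\<close>.\<close>
      define c' where "c' k = (if k \<in> {1..?N - y i} then c (Inr (y, i, k)) else 0)" for k
      have "(\<Sum>k\<in>{1..?N}. c' k *s b0 i k) = (\<Sum>k\<in>{1..?N - y i}. c (Inr (y, i, k)) *s b0 i k)"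
        by (intro sum.mono_neutral_cong_right) (auto simp: c'_def)
      also have "\<dots> = 0" using v[OF that(1,2)] v0[OF that(1)] by simp
      finally have "\<forall>k\<in>{1..?N}. c' k = 0" using b0 that(2) unfolding ordered_basis_iff by blast
      then have "c' j = 0" using that(3) by auto
      then show ?thesis using that(3) unfolding c'_def by simp
    qed
    ultimately show "\<forall>s\<in>S. c s = 0" unfolding S_def by auto
  qed
  have Q: "\<forall>y\<in>I. v y = 0"
    if b: "\<forall>i\<in>{1..d}. ordered_basis (b i)" "C b"
      and v: "\<forall>y\<in>I. \<forall>i\<in>{1..d}. v y \<in> flags_of d b i (?N - y i)" "(\<Sum>y\<in>I. v y) = 0" for b v
  proof -
    have "\<exists>c. v y = (\<Sum>j\<in>{1..?N - y i}. c j *s b i j)" if "y \<in> I" "i \<in> {1..d}" for y i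
      using v(1) that by (intro span_image_coeffs) (auto simp: flags_of_def flag_of_def)
    then obtain c where c: "\<And>y i. y \<in> I \<Longrightarrow> i \<in> {1..d} \<Longrightarrow>
        v y = (\<Sum>j\<in>{1..?N - y i}. c y i j *s b i j)" by metis
    define c' where "c' s = (case s of Inl (y, a) \<Rightarrow> vec_nth (v y) a | Inr (y, i, j) \<Rightarrow> c y i j)" for s
    have "(\<Sum>s\<in>S. M r s b * c' s) = 0" if rR: "r \<in> R" for r
    proof (cases r)
      case (Inl t)
      then obtain y i a where r: "r = Inl (y, i, a)" "y \<in> I" "i \<in> {1..d}"
        using rR unfolding R_def by (cases t) auto
      then show ?thesis
        using row1[OF r(2,3), of a b c'] arg_cong[OF c[OF r(2,3)], of "\<lambda>v. vec_nth v a"]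
        by (simp add: c'_def)
    next
      case (Inr a)
      then show ?thesis using row2[of a b c'] arg_cong[OF v(2), of "\<lambda>v. vec_nth v a"]
        by (simp add: c'_def)
    qed
    then have "\<forall>s\<in>S. c' s = 0" using b(2) unfolding C_def by blast
    moreover have "Inl (y, a) \<in> S" if "y \<in> I" for y a using that unfolding S_def by auto
    ultimately have "vec_nth (v y) a = 0" if "y \<in> I" for y a
      using that by (auto simp: c'_def dest!: bspec)
    then show ?thesis by (simp add: Finite_Cartesian_Product.vec_eq_iff)
  qed
  show ?thesis
    by (rule generically_of_basis_open[OF op, of b0]) (use b0 \<open>C b0\<close> Q in auto)
qed

section \<open>From dots of a floor to vectors of the flag\<close>

text \<open>A dot lies in its own principal subarray, which is therefore nonempty. The index
  \<open>i\<close> excludes the empty coordinate range, where every \<open>r\<close> satisfies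
  \<open>has_rank\<close>.\<close>

lemma array_rank_principal_pos:
  assumes "permutation_array n d Q" "x \<in> Q" "i \<in> {1..d}"
  shows "array_rank d (principal d Q x) > 0"
proof -
  have x: "x \<in> grid n d" "rankable d (principal d Q x)"
    using assms(1,2) unfolding permutation_array_def totally_rankable_def by auto
  then obtain r where r: "has_rank d (principal d Q x) r" unfolding rankable_def by blast
  have card: "card ((\<lambda>y. y i) ` principal d Q x) = r'" if "has_rank d (principal d Q x) r'" for r'
    using that assms(3) unfolding has_rank_def by blast
  have "array_rank d (principal d Q x) = r"
    unfolding array_rank_def using r card by (intro the_equality) auto
  moreover have "Q \<subseteq> grid n d" using assms(1) unfolding permutation_array_def by blast
  then have "finite Q" by (rule finite_subset) (auto simp: grid_def intro!: finite_PiE)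
  then have "finite (principal d Q x)" unfolding principal_def by simp
  moreover have "x \<in> principal d Q x" using assms(2) unfolding principal_def by simp
  ultimately show ?thesis using card[OF r] by (metis card_gt_0_iff empty_iff finite_imageI image_eqI)
qed

text \<open>The rank of the floor at its own dot is positive, and it is the dimension of the
  intersection with \<open>F k\<close>.\<close>

lemma floor_dot_meets:
  fixes E :: "nat \<Rightarrow> 'n::finite flag"
  assumes k: "k \<in> {1..CARD('n)}" and d: "0 < d"
    and fl: "is_floor CARD('n) d P k Q" and x: "x \<in> Q"
    and dims: "describes_dimensions d P E F"
  shows "\<exists>v. v \<noteq> 0 \<and> v \<in> F k \<and> (\<forall>i\<in>{1..d}. v \<in> E i (x i))"
proof -
  have Q: "permutation_array CARD('n) d Q" using fl unfolding is_floor_def by blast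
  then have xg: "x \<in> grid CARD('n) d" using x unfolding permutation_array_def by blast
  let ?x = "x(d + 1 := k)"
  have "?x \<in> grid CARD('n) (d + 1)"
    using xg k unfolding grid_def by (auto simp: PiE_def Pi_def extensional_def)
  then have "vec.dim ((\<Inter>i\<in>{1..d}. E i (?x i)) \<inter> F (?x (d + 1))) =
      array_rank (d + 1) (principal (d + 1) P ?x)"
    using dims unfolding describes_dimensions_def by blast
  also have "\<dots> = array_rank d (principal d Q x)" using fl xg unfolding is_floor_def by simp
  also have "\<dots> > 0" by (rule array_rank_principal_pos[OF Q x, of 1]) (use d in simp)
  finally have "\<not> (\<Inter>i\<in>{1..d}. E i (?x i)) \<inter> F (?x (d + 1)) \<subseteq> {0}"
    by (metis less_irrefl vec.dim_eq_0)
  then obtain v where "v \<noteq> 0" "v \<in> (\<Inter>i\<in>{1..d}. E i (?x i))" "v \<in> F (?x (d + 1))" by auto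
  moreover have "?x i = x i" if "i \<in> {1..d}" for i using that by auto
  ultimately show ?thesis by auto
qed

text \<open>Relations concern the scaled vectors, as in \<open>generically_T_independent\<close>;
  since no \<open>v y\<close> is zero, the scalars vanish too.\<close>

lemma card_le_dim_of_lines:
  fixes v :: "'i \<Rightarrow> complex ^ 'n::finite"
  assumes "finite I" "\<And>y. y \<in> I \<Longrightarrow> v y \<noteq> 0" "\<And>y. y \<in> I \<Longrightarrow> v y \<in> V"
    and rel: "\<And>c. (\<Sum>y\<in>I. c y *s v y) = 0 \<Longrightarrow> \<forall>y\<in>I. c y *s v y = 0"
  shows "card I \<le> vec.dim V"
proof -
  have c0: "\<forall>y\<in>I. c y = 0" if "(\<Sum>y\<in>I. c y *s v y) = 0" for c
    using rel[OF that] assms(2) by auto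
  have inj: "inj_on v I"
  proof (rule inj_onI, rule ccontr)
    fix y z assume yz: "y \<in> I" "z \<in> I" "v y = v z" "y \<noteq> z"
    define c :: "'i \<Rightarrow> complex" where "c i = (if i = y then 1 else if i = z then - 1 else 0)" for i
    have "(\<Sum>i\<in>I. c i *s v i) = (\<Sum>i\<in>{y, z}. c i *s v i)"
      using yz assms(1) by (intro sum.mono_neutral_right) (auto simp: c_def)
    also have "\<dots> = 0" using yz by (simp add: c_def)
    finally have "c y = 0" using c0 yz by blast
    then show False by (simp add: c_def)
  qed
  have "vec.independent (v ` I)"
  proof (rule vec.independent_if_scalars_zero)
    fix f x assume "(\<Sum>x\<in>v ` I. f x *s x) = 0" and x: "x \<in> v ` I"
    then have "(\<Sum>y\<in>I. f (v y) *s v y) = 0" by (simp add: sum.reindex[OF inj])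
    from c0[OF this] x show "f x = 0" by blast
  qed (use assms(1) in simp)
  then have "card (v ` I) \<le> vec.dim V"
    using assms(3) by (intro vec.independent_card_le_dim) auto
  then show ?thesis by (simp add: card_image[OF inj])
qed

lemma T_rank_witness:
  assumes "k < T_rank n d S" "finite S"
  shows "\<exists>I \<subseteq> S. T_indep n d I \<and> k < card I"
proof -
  \<comment> \<open>The empty set makes the family nonempty, so \<open>Max\<close> is
    attained.\<close>
  have "T_indep n d {}" unfolding T_indep_def by simp
  then have "T_rank n d S \<in> card ` {I. I \<subseteq> S \<and> T_indep n d I}"
    unfolding T_rank_def using assms(2) by (intro Max_in) auto
  with assms(1) show ?thesis by auto
qed

text \<open>Any other generic value agrees with 0, because two generic properties hold together at
  some tuple.\<close>

lemma schubert_number_eq_0: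
  assumes "generically d (\<lambda>E :: nat \<Rightarrow> 'n::finite flag. schubert_intersection d w E = {})"
  shows "schubert_number TYPE('n) d w = 0"
  unfolding schubert_number_def
proof (rule the_equality)
  show "generically d (\<lambda>E :: nat \<Rightarrow> 'n flag.
      finite (schubert_intersection d w E) \<and> card (schubert_intersection d w E) = 0)"
    by (rule generically_mono[OF assms]) simp
  fix c assume "generically d (\<lambda>E :: nat \<Rightarrow> 'n flag.
      finite (schubert_intersection d w E) \<and> card (schubert_intersection d w E) = c)"
  from generically_ex[OF generically_conj[OF assms this]] show "c = 0" by auto
qed

theorem proposition9p7:
  fixes d :: nat
    and w :: "nat \<Rightarrow> nat \<Rightarrow> nat"
    and P :: "(nat \<Rightarrow> nat) set"
    and P_floor :: "nat \<Rightarrow> (nat \<Rightarrow> nat) set"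
  assumes "\<forall>i\<in>{1..d}. w i permutes {1..CARD('n::finite)}"
    and "(\<Sum>i\<in>{1..d}. perm_length CARD('n) (w i)) = CARD('n) choose 2"
    and "permutation_array CARD('n) (d + 1) P"
    and "has_rank (d + 1) P CARD('n)"
    and "generically d (\<lambda>E :: nat \<Rightarrow> 'n flag.
           \<forall>F\<in>schubert_intersection d w E. describes_dimensions d P E F)"
    and "\<forall>k\<in>{1..CARD('n)}. is_floor CARD('n) d P k (P_floor k)"
    and "P_floor CARD('n) = transversal_array CARD('n) d"
    and "\<exists>k\<in>{1..CARD('n)}.
           T_rank CARD('n) d (to_T CARD('n) d ` (P_floor k \<inter> P_floor CARD('n))) > k"
  shows "generically d (\<lambda>E :: nat \<Rightarrow> 'n flag. schubert_intersection d w E = {})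
         \<and> schubert_number TYPE('n) d w = 0"
proof -
  let ?N = "CARD('n)"
  obtain k where k: "k \<in> {1..?N}"
    and rank: "k < T_rank ?N d (to_T ?N d ` (P_floor k \<inter> P_floor ?N))" using assms(8) by blast
  have fl: "is_floor ?N d P k (P_floor k)" using assms(6) k by blast
  have grid: "P_floor k \<subseteq> grid ?N d"
    using fl unfolding is_floor_def permutation_array_def by blast
  then have "finite (P_floor k)"
    by (rule finite_subset) (auto simp: grid_def intro!: finite_PiE)
  then obtain I where I: "I \<subseteq> to_T ?N d ` P_floor k" "T_indep ?N d I" "k < card I"
    using T_rank_witness[OF rank] by blast
  \<comment> \<open>With no flags the length condition forces \<open>?N \<le> 1\<close>, against
    \<open>1 \<le> k < card I \<le> ?N\<close>.\<close>
  have "d \<noteq> 0"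
  proof
    assume "d = 0"
    then have "?N choose 2 = 0" using assms(2) by simp
    then have "?N \<le> 1" by (simp add: not_less)
    moreover have "card I \<le> ?N" using T_indep_card_le[OF I(2)] by simp
    ultimately show False using I(3) k by simp
  qed
  have empty: "schubert_intersection d w E = {}"
    if dims: "\<forall>F\<in>schubert_intersection d w E. describes_dimensions d P E F"
      and indep: "\<forall>v. (\<forall>y\<in>I. \<forall>i\<in>{1..d}. v y \<in> E i (?N - y i)) \<longrightarrow> (\<Sum>y\<in>I. v y) = 0 \<longrightarrow>
        (\<forall>y\<in>I. v y = 0)"
      and E: "E \<in> flag_tuples d" for E :: "nat \<Rightarrow> 'n flag"
  proof (rule ccontr)
    assume "schubert_intersection d w E \<noteq> {}"
    then obtain F where F: "F \<in> schubert_intersection d w E" by blast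
    have "\<exists>v. v \<noteq> 0 \<and> v \<in> F k \<and> (\<forall>i\<in>{1..d}. v \<in> E i (?N - y i))" if y: "y \<in> I" for y
    proof -
      obtain x where x: "x \<in> P_floor k" "y = to_T ?N d x" using y I(1) by blast
      \<comment> \<open>The truncated subtraction in \<open>to_T\<close> is undone because
        \<open>x i \<le> ?N\<close>.\<close>
      have "?N - y i = x i" if "i \<in> {1..d}" for i
        using that x grid unfolding to_T_def grid_def by (fastforce simp: PiE_def Pi_def)
      then show ?thesis
        using floor_dot_meets[OF k _ fl x(1), of E F] dims F \<open>d \<noteq> 0\<close> by simp
    qed
    then obtain v where v: "\<And>y. y \<in> I \<Longrightarrow> v y \<noteq> 0 \<and> v y \<in> F k \<and> (\<forall>i\<in>{1..d}. v y \<in> E i (?N - y i))"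
      by metis
    have "card I \<le> vec.dim (F k)"
    proof (rule card_le_dim_of_lines[of I v])
      fix c assume "(\<Sum>y\<in>I. c y *s v y) = 0"
      \<comment> \<open>Scaling stays inside the subspace, so \<open>indep\<close> applies to the
        vectors \<open>c y *s v y\<close>.\<close>
      moreover have "c y *s v y \<in> E i (?N - y i)" if y: "y \<in> I" and i: "i \<in> {1..d}" for y i
      proof -
        have "E i \<in> complete_flags" using E i unfolding flag_tuples_def by blast
        then have "vec.subspace (E i (?N - y i))" unfolding complete_flags_def by simp
        then show ?thesis using v[OF y] i by (intro vec.subspace_scale) auto
      qed
      ultimately show "\<forall>y\<in>I. c y *s v y = 0"
        using spec[OF indep, of "\<lambda>y. c y *s v y"] by blast
    qed (use v finite_T_indep[OF I(2)] in auto)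
    moreover have "F \<in> complete_flags" using F unfolding schubert_intersection_def by blast
    then have "vec.dim (F k) = k" using k unfolding complete_flags_def by simp
    ultimately show False using I(3) by simp
  qed
  have "generically d (\<lambda>E :: nat \<Rightarrow> 'n flag. schubert_intersection d w E = {})"
    by (rule generically_mono[OF generically_conj[OF assms(5) generically_T_independent[OF I(2)]]])
      (elim conjE, rule empty; assumption)
  then show ?thesis using schubert_number_eq_0 by blast
qed

end
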